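(* Let $(X,d,A)$ be a metric pair with $A\neq\emptyset$. Let $T:\mathrm{Lip}(X,A)\to\mathbb{R}$ be an order bounded, sequentially order continuous linear functional which is exhausted by compact sets. Then there exist measures $\mu,\nu\in\mathcal{M}_1^+(X,A)$ such that $T(f)=\int_X f\,d(\mu-\nu)$ for all $f\in\mathrm{Lip}(X,A)$. Moreover, $\mu$ and $\nu$ can be chosen uniquely such that, for all $f\in\mathrm{Lip}^+(X,A)$, $$\inf\Bigl\{\int_X g\,d\mu+\int_X h\,d\nu\ \Big|\ g+h=f,\ g,h\in\mathrm{Lip}^+(X,A)\Bigr\}=0.$$
   Context: A metric pair $(X,d,A)$ is a metric space $(X,d)$ with a closed subset $A\subset X$; $d_A(x)=\inf_{a\in A}d(x,a)$. Measures take values in $[0,\infty]$. Let $\mathcal{B}^+(X)$ be the commutative monoid of Borel measures on $X$ and $\mathcal{B}^+(X,A)=\mathcal{B}^+(X)/\mathcal{B}^+(A)$ the quotient monoid: $\mu\sim\nu$ iff $\mu+\sigma=\nu+\tau$ for some Borel measures $\sigma,\tau$ concentrated on $A$; equivalently $\mu,\nu$ agree on Borel subsets of $X\setminus A$, so relative Borel measures correspond bijectively to Borel measures on $X\setminus A$. For $f$ vanishing on $A$, $\int_X f\,d\mu$ is well defined, and $\int f\,d(\mu-\nu)=\int f\,d\mu-\int f\,d\nu$. $\mu$ is tight if $\mu(E)=\sup\{\mu(K): K\subset E \text{ compact}\}$ for every Borel $E\subset X\setminus A$. $\mathcal{M}_1^+(X,A)$ is the set of tight $\mu\in\mathcal{B}^+(X,A)$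 with $\int d_A\,d\mu<\infty$. $\mathrm{Lip}(X,A)$ is the Riesz space (vector lattice) of Lipschitz functions $f:X\to\mathbb{R}$ with $f|_A=0$, ordered pointwise; $\mathrm{Lip}^+(X,A)$ is its set of nonnegative elements. A linear functional is order bounded if it maps order intervals to bounded sets; order bounded functionals form a Riesz space ordered by the cone of positive functionals, and $|T|=T\vee(-T)$ there. In a Riesz space $E$, $x_n\xrightarrow{o}0$ means there is a decreasing sequence $(y_n)$ in $E$ with infimum $0$ in $E$ and $|x_n|\le y_n$; $T$ is sequentially order continuous if $x_n\xrightarrow{o}0$ implies $T(x_n)\to0$. A positive linear functional $S$ on $\mathrm{Lip}(X,A)$ is exhausted by compact sets if for all $f\in\mathrm{Lip}^+(X,A)$ and $\varepsilon>0$ there is a compact $K\subset X\setminus A$ such that $\sup\{S(g): g\in\mathrm{Lip}^+(X,A),\ g|_K=0,\ g\le f\}<\varepsilon$; an order bounded $T$ is exhausted by compact sets if $|T|$ is. *)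

theory Defs
  imports "HOL-Analysis.Analysis"
begin

section \<open>Relative Borel measures\<close>

definition borel_measures :: "'a::topological_space measure set" where
  "borel_measures = {\<mu>. sets \<mu> = sets borel}"

text \<open>Borel measures on a closed set \<open>A\<close> are identified with the Borel measures on the whole
  space that are concentrated on \<open>A\<close>.\<close>

definition borel_measures_on :: "'a::topological_space set \<Rightarrow> 'a measure set" where
  "borel_measures_on A = {\<sigma> \<in> borel_measures. emeasure \<sigma> (- A) = 0}"

definition rel_equiv :: "'a::topological_space set \<Rightarrow> ('a measure \<times> 'a measure) set" where
  "rel_equiv A = {(\<mu>, \<nu>). \<mu> \<in> borel_measures \<and> \<nu> \<in> borel_measures \<and>
     (\<exists>\<sigma>\<in>borel_measures_on A. \<exists>\<tau>\<in>borel_measures_on A. \<forall>E\<in>sets borel.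
        emeasure \<mu> E + emeasure \<sigma> E = emeasure \<nu> E + emeasure \<tau> E)}"

definition rel_borel_measures :: "'a::topological_space set \<Rightarrow> 'a measure set set" where
  "rel_borel_measures A = borel_measures // rel_equiv A"

text \<open>Evaluation of, and integration against, a relative measure are computed with an arbitrary
  representative. For sets disjoint from \<open>A\<close> and functions vanishing on \<open>A\<close> the choice does not
  matter, see \<open>rel_emeasure_eq\<close>, \<open>rel_nn_integral_eq\<close>, \<open>rel_integral_eq\<close> below.\<close>

definition rel_emeasure :: "'a measure set \<Rightarrow> 'a set \<Rightarrow> ennreal" where
  "rel_emeasure c E = emeasure (SOME m. m \<in> c) E"

definition rel_nn_integral :: "'a measure set \<Rightarrow> ('a \<Rightarrow> ennreal) \<Rightarrow> ennreal" where
  "rel_nn_integral c f = integral\<^sup>N (SOME m. m \<in> c) f"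

definition rel_integral :: "'a measure set \<Rightarrow> ('a \<Rightarrow> real) \<Rightarrow> real" where
  "rel_integral c f = integral\<^sup>L (SOME m. m \<in> c) f"

definition rel_tight :: "'a::topological_space set \<Rightarrow> 'a measure set \<Rightarrow> bool" where
  "rel_tight A c \<longleftrightarrow> (\<forall>E\<in>sets borel. E \<subseteq> - A \<longrightarrow>
     rel_emeasure c E = (SUP K\<in>{K. compact K \<and> K \<subseteq> E}. rel_emeasure c K))"

definition M1_plus :: "'a::metric_space set \<Rightarrow> 'a measure set set" where
  "M1_plus A = {c \<in> rel_borel_measures A. rel_tight A c \<and>
     rel_nn_integral c (\<lambda>x. ennreal (infdist x A)) < \<infinity>}"

lemma rel_equiv_iff:
  fixes A :: "'a::topological_space set"
  assumes "closed A"
  shows "(\<mu>, \<nu>) \<in> rel_equiv A \<longleftrightarrow> \<mu> \<in> borel_measures \<and> \<nu> \<in> borel_measures \<and>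
     (\<forall>E\<in>sets borel. E \<subseteq> - A \<longrightarrow> emeasure \<mu> E = emeasure \<nu> E)"
proof (intro iffI conjI ballI impI)
  have A: "A \<in> sets borel" using assms by simp
  assume r: "(\<mu>, \<nu>) \<in> rel_equiv A"
  then show "\<mu> \<in> borel_measures" "\<nu> \<in> borel_measures" by (auto simp: rel_equiv_def)
  fix E :: "'a set" assume E: "E \<in> sets borel" "E \<subseteq> - A"
  from r obtain \<sigma> \<tau> where st: "\<sigma> \<in> borel_measures_on A" "\<tau> \<in> borel_measures_on A"
    and eq: "emeasure \<mu> E + emeasure \<sigma> E = emeasure \<nu> E + emeasure \<tau> E"
    using E(1) unfolding rel_equiv_def by blast
  have "emeasure \<rho> E = 0" if "\<rho> \<in> borel_measures_on A" for \<rho>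
    by (rule emeasure_eq_0[of "- A"])
      (use that E A in \<open>auto simp: borel_measures_on_def borel_measures_def\<close>)
  with st eq show "emeasure \<mu> E = emeasure \<nu> E" by simp
next
  have A: "A \<in> sets borel" using assms by simp
  assume r: "\<mu> \<in> borel_measures \<and> \<nu> \<in> borel_measures \<and>
     (\<forall>E\<in>sets borel. E \<subseteq> - A \<longrightarrow> emeasure \<mu> E = emeasure \<nu> E)"
  then have s: "sets \<mu> = sets borel" "sets \<nu> = sets borel" by (auto simp: borel_measures_def)
  let ?\<sigma> = "density \<nu> (indicator A)" and ?\<tau> = "density \<mu> (indicator A)"
  have d: "emeasure (density \<rho> (indicator A)) E = emeasure \<rho> (A \<inter> E)"
    if "sets \<rho> = sets borel" "E \<in> sets borel" for \<rho> :: "'a measure" and E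
    using that A by (simp add: emeasure_restricted)
  have "?\<sigma> \<in> borel_measures_on A" "?\<tau> \<in> borel_measures_on A"
    using s A by (simp_all add: d borel_measures_on_def borel_measures_def)
  moreover have "emeasure \<mu> E + emeasure ?\<sigma> E = emeasure \<nu> E + emeasure ?\<tau> E"
    if E: "E \<in> sets borel" for E
  proof -
    have split: "emeasure \<rho> E = emeasure \<rho> (E - A) + emeasure \<rho> (A \<inter> E)"
      if "sets \<rho> = sets borel" for \<rho> :: "'a measure"
    proof -
      have "emeasure \<rho> (E - A) + emeasure \<rho> (A \<inter> E) = emeasure \<rho> ((E - A) \<union> (A \<inter> E))"
        using that E A by (intro plus_emeasure) auto
      also have "(E - A) \<union> (A \<inter> E) = E" by blast
      finally show ?thesis by simp
    qed
    have "E - A \<in> sets borel" "E - A \<subseteq> - A" using E A by auto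
    then have "emeasure \<mu> (E - A) = emeasure \<nu> (E - A)" using r by blast
    then show ?thesis
      unfolding d[OF s(1) E] d[OF s(2) E] split[OF s(1)] split[OF s(2)] by (simp add: ac_simps)
  qed
  ultimately have "\<exists>\<sigma>\<in>borel_measures_on A. \<exists>\<tau>\<in>borel_measures_on A. \<forall>E\<in>sets borel.
      emeasure \<mu> E + emeasure \<sigma> E = emeasure \<nu> E + emeasure \<tau> E"
    by (intro bexI[of _ ?\<sigma>] bexI[of _ ?\<tau>] ballI)
  with r show "(\<mu>, \<nu>) \<in> rel_equiv A" by (simp add: rel_equiv_def)
qed

lemma equiv_rel_equiv:
  assumes "closed A"
  shows "equiv borel_measures (rel_equiv A)"
  by (rule equivI) (auto simp: refl_on_def sym_def trans_def rel_equiv_iff[OF assms])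

lemma rel_borel_measures_repr:
  assumes "closed A" "c \<in> rel_borel_measures A" "m \<in> c"
  shows "((SOME m. m \<in> c), m) \<in> rel_equiv A"
  using assms someI[of "\<lambda>m. m \<in> c" m]
  by (auto simp: rel_borel_measures_def dest: in_quotient_imp_in_rel[OF equiv_rel_equiv])

lemma rel_emeasure_eq:
  assumes "closed A" "c \<in> rel_borel_measures A" "m \<in> c" "E \<in> sets borel" "E \<subseteq> - A"
  shows "rel_emeasure c E = emeasure m E"
  using rel_borel_measures_repr[OF assms(1-3)] assms
  by (simp add: rel_equiv_iff rel_emeasure_def)

lemma rel_equiv_density:
  assumes "closed A" "(\<mu>, \<nu>) \<in> rel_equiv A"
  shows "density \<mu> (indicator (- A)) = density \<nu> (indicator (- A))"
proof (rule measure_eqI)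
  have s: "sets \<mu> = sets borel" "sets \<nu> = sets borel"
    using assms by (auto simp: rel_equiv_iff borel_measures_def)
  then show "sets (density \<mu> (indicator (- A))) = sets (density \<nu> (indicator (- A)))" by simp
  fix E assume "E \<in> sets (density \<mu> (indicator (- A)))"
  then have "E \<in> sets borel" "- A \<inter> E \<in> sets borel" using s assms by auto
  then show "emeasure (density \<mu> (indicator (- A))) E = emeasure (density \<nu> (indicator (- A))) E"
    using assms s by (simp add: emeasure_restricted rel_equiv_iff)
qed

lemma rel_nn_integral_eq:
  assumes "closed A" "c \<in> rel_borel_measures A" "m \<in> c"
    and f: "f \<in> borel_measurable borel" "\<And>x. x \<in> A \<Longrightarrow> f x = 0"
  shows "rel_nn_integral c f = integral\<^sup>N m f"
proof -
  let ?n = "SOME m. m \<in> c"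
  have r: "(?n, m) \<in> rel_equiv A" using rel_borel_measures_repr assms by blast
  have *: "integral\<^sup>N \<mu> f = integral\<^sup>N (density \<mu> (indicator (- A))) f"
    if "\<mu> \<in> borel_measures" for \<mu>
  proof -
    have s: "sets \<mu> = sets borel" using that by (simp add: borel_measures_def)
    have "f \<in> borel_measurable \<mu>" "indicator (- A) \<in> borel_measurable \<mu>"
      using f assms(1) s by (auto simp: measurable_cong_sets[OF s refl])
    then show ?thesis
      by (subst nn_integral_density) (auto intro!: nn_integral_cong simp: f(2) indicator_def)
  qed
  show ?thesis
    using r unfolding rel_nn_integral_def
    by (metis * assms(1) rel_equiv_density rel_equiv_iff)
qed

lemma rel_integral_eq:
  assumes "closed A" "c \<in> rel_borel_measures A" "m \<in> c"
    and f: "f \<in> borel_measurable borel" "\<And>x. x \<in> A \<Longrightarrow> f x = 0"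
  shows "rel_integral c f = integral\<^sup>L m f"
proof -
  let ?n = "SOME m. m \<in> c"
  have r: "(?n, m) \<in> rel_equiv A" using rel_borel_measures_repr assms by blast
  have *: "integral\<^sup>L \<mu> f = integral\<^sup>L (density \<mu> (indicator (- A))) f"
    if "\<mu> \<in> borel_measures" for \<mu>
  proof -
    have s: "sets \<mu> = sets borel" using that by (simp add: borel_measures_def)
    have m: "f \<in> borel_measurable \<mu>" "(indicator (- A) :: _ \<Rightarrow> real) \<in> borel_measurable \<mu>"
      using f assms(1) s by (auto simp: measurable_cong_sets[OF s refl])
    have "density \<mu> (indicator (- A)) = density \<mu> (\<lambda>x. ennreal (indicator (- A) x))"
      by (simp add: ennreal_indicator)
    then have "integral\<^sup>L (density \<mu> (indicator (- A))) f = (\<integral>x. indicator (- A) x *\<^sub>R f x \<partial>\<mu>)"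
      using m by (simp add: integral_density)
    also have "\<dots> = integral\<^sup>L \<mu> f"
      by (intro Bochner_Integration.integral_cong) (auto simp: f(2) indicator_def)
    finally show ?thesis by simp
  qed
  show ?thesis
    using r unfolding rel_integral_def
    by (metis * assms(1) rel_equiv_density rel_equiv_iff)
qed

section \<open>Lipschitz functions\<close>

definition Lip :: "'a::metric_space set \<Rightarrow> ('a \<Rightarrow> real) set" where
  "Lip A = {f. (\<exists>L. L-lipschitz_on UNIV f) \<and> (\<forall>x\<in>A. f x = 0)}"

definition nonneg_part :: "('a \<Rightarrow> real) set \<Rightarrow> ('a \<Rightarrow> real) set" where
  "nonneg_part E = {f \<in> E. \<forall>x. 0 \<le> f x}"

abbreviation Lip_plus :: "'a::metric_space set \<Rightarrow> ('a \<Rightarrow> real) set" where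
  "Lip_plus A \<equiv> nonneg_part (Lip A)"

section \<open>Functionals on a Riesz space of real functions\<close>

text \<open>In this section \<open>E\<close> is a vector space of real functions closed under pointwise maxima and
  minima, so that its lattice operations are the pointwise ones and \<open>\<le>\<close> is the order of \<open>E\<close>.
  A functional on \<open>E\<close> is a total function of which only the values on \<open>E\<close> are relevant.\<close>

definition linear_functional :: "('a \<Rightarrow> real) set \<Rightarrow> (('a \<Rightarrow> real) \<Rightarrow> real) \<Rightarrow> bool" where
  "linear_functional E T \<longleftrightarrow>
     (\<forall>f\<in>E. \<forall>g\<in>E. T (\<lambda>x. f x + g x) = T f + T g) \<and>
     (\<forall>c. \<forall>f\<in>E. T (\<lambda>x. c * f x) = c * T f)"

definition order_bounded :: "('a \<Rightarrow> real) set \<Rightarrow> (('a \<Rightarrow> real) \<Rightarrow> real) \<Rightarrow> bool" where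
  "order_bounded E T \<longleftrightarrow> (\<forall>a\<in>E. \<forall>b\<in>E. bounded (T ` {f\<in>E. a \<le> f \<and> f \<le> b}))"

definition order_dual :: "('a \<Rightarrow> real) set \<Rightarrow> (('a \<Rightarrow> real) \<Rightarrow> real) set" where
  "order_dual E = {T. linear_functional E T \<and> order_bounded E T}"

definition functional_le ::
  "('a \<Rightarrow> real) set \<Rightarrow> (('a \<Rightarrow> real) \<Rightarrow> real) \<Rightarrow> (('a \<Rightarrow> real) \<Rightarrow> real) \<Rightarrow> bool" where
  "functional_le E S T \<longleftrightarrow> (\<forall>f\<in>nonneg_part E. 0 \<le> T f - S f)"

text \<open>\<open>S\<close> is the supremum of \<open>T\<close> and \<open>- T\<close> in the order dual; on \<open>E\<close> it is determined by \<open>T\<close>.\<close>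

definition is_modulus ::
  "('a \<Rightarrow> real) set \<Rightarrow> (('a \<Rightarrow> real) \<Rightarrow> real) \<Rightarrow> (('a \<Rightarrow> real) \<Rightarrow> real) \<Rightarrow> bool" where
  "is_modulus E T S \<longleftrightarrow> S \<in> order_dual E \<and>
     functional_le E T S \<and> functional_le E (\<lambda>f. - T f) S \<and>
     (\<forall>U\<in>order_dual E. functional_le E T U \<and> functional_le E (\<lambda>f. - T f) U
        \<longrightarrow> functional_le E S U)"

text \<open>The infimum of the dominating sequence is taken in \<open>E\<close>; it need not be the pointwise
  infimum.\<close>

definition order_null :: "('a \<Rightarrow> real) set \<Rightarrow> (nat \<Rightarrow> 'a \<Rightarrow> real) \<Rightarrow> bool" where
  "order_null E f \<longleftrightarrow> (\<exists>y. (\<forall>n. y n \<in> E) \<and> decseq y \<and>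
     (\<forall>n. (\<lambda>_. 0) \<le> y n) \<and>
     (\<forall>z\<in>E. (\<forall>n. z \<le> y n) \<longrightarrow> z \<le> (\<lambda>_. 0)) \<and>
     (\<forall>n. (\<lambda>x. \<bar>f n x\<bar>) \<le> y n))"

definition seq_order_continuous :: "('a \<Rightarrow> real) set \<Rightarrow> (('a \<Rightarrow> real) \<Rightarrow> real) \<Rightarrow> bool" where
  "seq_order_continuous E T \<longleftrightarrow>
     (\<forall>f. (\<forall>n. f n \<in> E) \<and> order_null E f \<longrightarrow> (\<lambda>n. T (f n)) \<longlonglongrightarrow> 0)"

section \<open>Exhaustion by compact sets\<close>

definition pos_exhausted_by_compacts ::
  "'a::metric_space set \<Rightarrow> (('a \<Rightarrow> real) \<Rightarrow> real) \<Rightarrow> bool" where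
  "pos_exhausted_by_compacts A S \<longleftrightarrow> (\<forall>f\<in>Lip_plus A. \<forall>\<epsilon>>0.
     \<exists>K. compact K \<and> K \<subseteq> - A \<and>
       Sup {S g | g. g \<in> Lip_plus A \<and> (\<forall>x\<in>K. g x = 0) \<and> g \<le> f} < \<epsilon>)"

definition exhausted_by_compacts ::
  "'a::metric_space set \<Rightarrow> (('a \<Rightarrow> real) \<Rightarrow> real) \<Rightarrow> bool" where
  "exhausted_by_compacts A T \<longleftrightarrow>
     (\<exists>S. is_modulus (Lip A) T S \<and> pos_exhausted_by_compacts A S)"

section \<open>Representing pairs\<close>

definition represents ::
  "'a::metric_space set \<Rightarrow> (('a \<Rightarrow> real) \<Rightarrow> real) \<Rightarrow> 'a measure set \<Rightarrow> 'a measure set \<Rightarrow> bool" where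
  "represents A T \<mu> \<nu> \<longleftrightarrow> (\<forall>f\<in>Lip A. T f = rel_integral \<mu> f - rel_integral \<nu> f)"

definition minimal_pair ::
  "'a::metric_space set \<Rightarrow> 'a measure set \<Rightarrow> 'a measure set \<Rightarrow> bool" where
  "minimal_pair A \<mu> \<nu> \<longleftrightarrow> (\<forall>f\<in>Lip_plus A.
     Inf {rel_integral \<mu> g + rel_integral \<nu> h | g h.
       g \<in> Lip_plus A \<and> h \<in> Lip_plus A \<and> (\<lambda>x. g x + h x) = f} = 0)"

end

theory Submission
  imports Defs
begin

text \<open>
  Let \<open>S\<close> be the modulus of \<open>T\<close>. The positive functionals \<open>P = (S + T) / 2\<close> and \<open>N = (S - T) / 2\<close> are
  dominated by \<open>S\<close>, so they are exhausted by compact sets. Dini's theorem on these compact sets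
  makes such a functional continuous along pointwise null sequences, and the Daniell construction
  yields a Borel measure, carried by the complement of \<open>A\<close>, that represents it. The measure with
  density \<open>d\<^sub>A\<close> is finite; finite Borel measures on metric spaces are inner regular for closed sets,
  and the exhaustion turns closed sets into compact ones, which gives tightness. The pair is minimal
  because \<open>S - 2 (P \<and> N)\<close> still dominates \<open>T\<close> and \<open>- T\<close>, so \<open>P \<and> N = 0\<close>. For any minimal pair
  \<open>\<integral> f d\<mu>\<close> is the supremum of \<open>T u\<close> over \<open>0 \<le> u \<le> f\<close>, so \<open>T\<close> determines \<open>\<mu>\<close> and \<open>\<nu>\<close>.
\<close>

section \<open>Lipschitz functions vanishing on a set\<close>

text \<open>Nonzero constants are not in \<open>Lip A\<close>, and the space need not be locally
  compact, so the usual Riesz theorem does not apply directly. The function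
  \<open>infdist x A\<close> takes over the role of the constant 1: it is positive off the closed
  set \<open>A\<close>, and every element of \<open>Lip A\<close> is bounded by a multiple of it. It
  is the threshold in the Dini argument, and as a density it tames a representing measure, which may
  have infinite mass near \<open>A\<close>. Truncation at nonnegative constants keeps functions in
  \<open>Lip_plus A\<close> (Stone's condition), which makes superlevel sets, hence layer sums,
  accessible to the functional. Since the upper integral uses countable covers by Lipschitz
  functions, Caratheodory's theorem applies as soon as open sets split every upper integral
  additively; open sets are reached from inside by \<open>min (f x) (k * infdist x C)\<close> with
  growing \<open>k\<close>. For uniqueness, a decomposition \<open>g + h = f\<close> that is nearly
  optimal for a minimal pair makes both the \<open>\<mu>\<close>-integral of \<open>g\<close> and
  the \<open>\<nu>\<close>-integral of \<open>h\<close> small, so that \<open>T h\<close>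
  approximates the \<open>\<mu>\<close>-integral of \<open>f\<close>.\<close>

lemma Lip_plusI:
  assumes "L-lipschitz_on UNIV f" "\<And>x. x \<in> A \<Longrightarrow> f x = 0" "\<And>x. 0 \<le> f x"
  shows "f \<in> Lip_plus A"
  using assms by (auto simp: nonneg_part_def Lip_def)

lemma Lip_plus_imp_Lip: "f \<in> Lip_plus A \<Longrightarrow> f \<in> Lip A"
  by (simp add: nonneg_part_def)

lemma Lip_plus_nonneg: "f \<in> Lip_plus A \<Longrightarrow> 0 \<le> f x"
  by (simp add: nonneg_part_def)

lemma Lip_zero_on: "f \<in> Lip A \<Longrightarrow> x \<in> A \<Longrightarrow> f x = 0"
  by (simp add: Lip_def)

lemma Lip_antimono: "B \<subseteq> A \<Longrightarrow> Lip A \<subseteq> Lip B"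
  by (auto simp: Lip_def)

lemma Lip_plus_antimono: "B \<subseteq> A \<Longrightarrow> Lip_plus A \<subseteq> Lip_plus B"
  by (auto simp: nonneg_part_def Lip_def)

lemma Lip_add: "f \<in> Lip A \<Longrightarrow> g \<in> Lip A \<Longrightarrow> (\<lambda>x. f x + g x) \<in> Lip A"
  by (auto simp: Lip_def intro: lipschitz_on_add)

lemma Lip_diff: "f \<in> Lip A \<Longrightarrow> g \<in> Lip A \<Longrightarrow> (\<lambda>x. f x - g x) \<in> Lip A"
  by (auto simp: Lip_def intro: lipschitz_on_diff)

lemma Lip_cmult: "f \<in> Lip A \<Longrightarrow> (\<lambda>x. c * f x) \<in> Lip A"
  by (auto simp: Lip_def intro: lipschitz_on_cmult_real)

lemma Lip_max_zero: "f \<in> Lip A \<Longrightarrow> (\<lambda>x. max (f x) 0) \<in> Lip_plus A"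
proof -
  assume f: "f \<in> Lip A"
  then obtain L where L: "L-lipschitz_on UNIV f" by (auto simp: Lip_def)
  have "L-lipschitz_on UNIV (\<lambda>x. max (f x) 0)"
  proof (rule lipschitz_onI)
    fix x y
    have "dist (f x) (f y) \<le> L * dist x y" using lipschitz_onD[OF L] by simp
    then show "dist (max (f x) 0) (max (f y) 0) \<le> L * dist x y"
      by (auto simp: dist_real_def max_def)
  qed (rule lipschitz_on_nonneg[OF L])
  then show ?thesis using f by (intro Lip_plusI) (auto simp: Lip_def)
qed

lemma Lip_plus_zero: "(\<lambda>x. 0) \<in> Lip_plus A"
  by (rule Lip_plusI[OF lipschitz_on_constant]) auto

lemma Lip_plus_const: "0 \<le> c \<Longrightarrow> (\<lambda>x. c) \<in> Lip_plus {}"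
  by (rule Lip_plusI[OF lipschitz_on_constant]) auto

lemma Lip_plus_add: "f \<in> Lip_plus A \<Longrightarrow> g \<in> Lip_plus A \<Longrightarrow> (\<lambda>x. f x + g x) \<in> Lip_plus A"
  by (auto simp: nonneg_part_def intro: Lip_add)

lemma Lip_plus_cmult: "f \<in> Lip_plus A \<Longrightarrow> 0 \<le> c \<Longrightarrow> (\<lambda>x. c * f x) \<in> Lip_plus A"
  by (auto simp: nonneg_part_def intro: Lip_cmult)

lemma Lip_plus_diff:
  "f \<in> Lip_plus A \<Longrightarrow> g \<in> Lip_plus A \<Longrightarrow> (\<And>x. g x \<le> f x) \<Longrightarrow> (\<lambda>x. f x - g x) \<in> Lip_plus A"
  by (auto simp: nonneg_part_def intro: Lip_diff)

lemma Lip_plus_sum: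
  "(\<And>i. i \<in> I \<Longrightarrow> f i \<in> Lip_plus A) \<Longrightarrow> (\<lambda>x. \<Sum>i\<in>I. f i x) \<in> Lip_plus A"
  by (induction I rule: infinite_finite_induct) (auto intro: Lip_plus_zero Lip_plus_add)

text \<open>Only \<open>f\<close> has to vanish on \<open>A\<close>, since \<open>g\<close> is
  nonnegative. Thus \<open>g\<close> may be a constant or a multiple of the distance to any set;
  \<open>Lip_plus {}\<close> consists of all nonnegative Lipschitz functions.\<close>

lemma Lip_plus_min:
  assumes f: "f \<in> Lip_plus A" and g: "g \<in> Lip_plus {}"
  shows "(\<lambda>x. min (f x) (g x)) \<in> Lip_plus A"
proof -
  have eq: "min (f x) (g x) = f x - max (f x - g x) 0" for x by auto
  have "f \<in> Lip {}" "g \<in> Lip {}"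
    using assms Lip_antimono[of "{}" A] by (auto simp: nonneg_part_def)
  then have "(\<lambda>x. min (f x) (g x)) \<in> Lip {}"
    unfolding eq by (intro Lip_diff Lip_plus_imp_Lip[OF Lip_max_zero])
  then show ?thesis
    using f g by (auto simp: Lip_def nonneg_part_def min_def)
qed

lemma infdist_Lip_plus: "A \<subseteq> B \<Longrightarrow> (\<lambda>x. infdist x B) \<in> Lip_plus A"
proof (rule Lip_plusI)
  show "1-lipschitz_on UNIV (\<lambda>x. infdist x B)"
    by (rule lipschitz_onI) (auto simp: dist_real_def infdist_triangle_abs)
qed (auto simp: infdist_nonneg)

lemma Lip_continuous_on: "f \<in> Lip A \<Longrightarrow> continuous_on S f"
  by (auto simp: Lip_def intro: continuous_on_subset[OF lipschitz_on_continuous_on])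

lemma Lip_borel_measurable: "f \<in> Lip A \<Longrightarrow> f \<in> borel_measurable borel"
  by (intro borel_measurable_continuous_onI Lip_continuous_on)

text \<open>Compare \<open>f x\<close> with \<open>f a = 0\<close> for \<open>a\<close> in
  \<open>A\<close> and take the infimum over \<open>a\<close>. This makes the distance to
  \<open>A\<close> an order unit.\<close>

lemma Lip_le_infdist:
  assumes "f \<in> Lip A" "A \<noteq> {}"
  obtains L where "0 \<le> L" "\<And>x. \<bar>f x\<bar> \<le> L * infdist x A"
proof -
  from assms obtain L where L: "L-lipschitz_on UNIV f" by (auto simp: Lip_def)
  have L0: "0 \<le> L" using L by (rule lipschitz_on_nonneg)
  have "\<bar>f x\<bar> \<le> L * infdist x A" for x
  proof (cases "L = 0")
    case True
    from assms obtain a where "a \<in> A" by auto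
    then show ?thesis
      using lipschitz_onD[OF L, of x a] Lip_zero_on[OF assms(1), of a] True by simp
  next
    case False
    have "\<bar>f x\<bar> / L \<le> infdist x A"
      unfolding infdist_notempty[OF assms(2)]
    proof (rule cINF_greatest[OF assms(2)])
      fix a assume "a \<in> A"
      then show "\<bar>f x\<bar> / L \<le> dist x a"
        using lipschitz_onD[OF L, of x a] Lip_zero_on[OF assms(1), of a] L0 False
        by (simp add: field_simps dist_real_def)
    qed
    then show ?thesis using L0 False by (simp add: field_simps)
  qed
  then show ?thesis using L0 that by blast
qed

text \<open>Off \<open>C\<close> the multiples of the positive distance eventually exceed
  \<open>f x\<close>; on \<open>C\<close> they vanish. So a function cut off to an open set is an
  increasing limit of Lipschitz functions.\<close>

lemma min_infdist_SUP:
  assumes "closed C" "C \<noteq> {}" "0 \<le> f x"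
  shows "(SUP k. ennreal (min (f x) (real k * infdist x C))) = ennreal (f x) * indicator (- C) x"
proof (cases "x \<in> C")
  case True
  then show ?thesis using assms(3) by (simp add: min_absorb2)
next
  case False
  then have "infdist x C > 0"
    using assms infdist_pos_not_in_closed by auto
  then obtain k where "f x < real k * infdist x C"
    using reals_Archimedean3 by blast
  then have "ennreal (f x) \<le> (SUP k. ennreal (min (f x) (real k * infdist x C)))"
    by (intro SUP_upper2[of k]) auto
  moreover have "(SUP k. ennreal (min (f x) (real k * infdist x C))) \<le> ennreal (f x)"
    by (intro SUP_least ennreal_leI) simp
  ultimately show ?thesis using False by simp
qed

lemma linear_functional_add:
  "linear_functional (Lip A) T \<Longrightarrow> f \<in> Lip A \<Longrightarrow> g \<in> Lip A \<Longrightarrow> T (\<lambda>x. f x + g x) = T f + T g"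
  by (simp add: linear_functional_def)

lemma linear_functional_cmult:
  "linear_functional (Lip A) T \<Longrightarrow> f \<in> Lip A \<Longrightarrow> T (\<lambda>x. c * f x) = c * T f"
  by (simp add: linear_functional_def)

lemma linear_functional_diff:
  assumes "linear_functional (Lip A) T" "f \<in> Lip A" "g \<in> Lip A"
  shows "T (\<lambda>x. f x - g x) = T f - T g"
  using linear_functional_add[OF assms(1,2) Lip_cmult[OF assms(3), of "-1"]]
    linear_functional_cmult[OF assms(1,3), of "-1"] by simp

section \<open>Positive functionals exhausted by compact sets\<close>

locale exhausted_functional =
  fixes A :: "'a::metric_space set" and P :: "('a \<Rightarrow> real) \<Rightarrow> real"
  assumes closed_A: "closed A" and A_nonempty: "A \<noteq> {}"
    and P_linear: "linear_functional (Lip A) P"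
    and P_nonneg: "f \<in> Lip_plus A \<Longrightarrow> 0 \<le> P f"
    and P_exhausted: "pos_exhausted_by_compacts A P"
begin

lemmas P_add = linear_functional_add[OF P_linear]
lemmas P_cmult = linear_functional_cmult[OF P_linear]
lemmas P_diff = linear_functional_diff[OF P_linear]

lemma P_zero: "P (\<lambda>x. 0) = 0"
  using P_cmult[of "\<lambda>x. 0" 0] Lip_plus_imp_Lip[OF Lip_plus_zero[of A]] by simp

lemma P_mono: "f \<in> Lip_plus A \<Longrightarrow> g \<in> Lip_plus A \<Longrightarrow> (\<And>x. f x \<le> g x) \<Longrightarrow> P f \<le> P g"
  using P_nonneg[OF Lip_plus_diff[of g A f]] P_diff[of g f] by (simp add: Lip_plus_imp_Lip)

lemma P_sum:
  "(\<And>i. i \<in> I \<Longrightarrow> f i \<in> Lip_plus A) \<Longrightarrow> P (\<lambda>x. \<Sum>i\<in>I. f i x) = (\<Sum>i\<in>I. P (f i))"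
proof (induction I rule: infinite_finite_induct)
  case (insert j I)
  then show ?case
    using P_add[of "f j" "\<lambda>x. \<Sum>i\<in>I. f i x"] Lip_plus_sum[of I f A] by (simp add: Lip_plus_imp_Lip)
qed (simp_all add: P_zero)

lemma infdist_A_pos: "x \<notin> A \<Longrightarrow> 0 < infdist x A"
  using closed_A A_nonempty by (simp add: infdist_pos_not_in_closed)

text \<open>The real \<open>Sup\<close> bounds the individual values because the set is bounded
  above by \<open>P f\<close>, by monotonicity.\<close>

lemma exhausted_compact:
  assumes f: "f \<in> Lip_plus A" and "0 < e"
  obtains K where "compact K" "K \<subseteq> - A"
    "\<And>g. g \<in> Lip_plus A \<Longrightarrow> (\<And>x. x \<in> K \<Longrightarrow> g x = 0) \<Longrightarrow> (\<And>x. g x \<le> f x) \<Longrightarrow> P g < e"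
proof -
  obtain K where K: "compact K" "K \<subseteq> - A"
    and sup: "Sup {P g | g. g \<in> Lip_plus A \<and> (\<forall>x\<in>K. g x = 0) \<and> g \<le> f} < e"
    using P_exhausted assms unfolding pos_exhausted_by_compacts_def by meson
  have "P g < e" if "g \<in> Lip_plus A" "\<And>x. x \<in> K \<Longrightarrow> g x = 0" "\<And>x. g x \<le> f x" for g
  proof (rule le_less_trans[OF cSup_upper sup])
    show "P g \<in> {P g | g. g \<in> Lip_plus A \<and> (\<forall>x\<in>K. g x = 0) \<and> g \<le> f}"
      using that by (auto simp: le_fun_def)
    show "bdd_above {P g | g. g \<in> Lip_plus A \<and> (\<forall>x\<in>K. g x = 0) \<and> g \<le> f}"
      using f by (intro bdd_aboveI[of _ "P f"]) (auto intro: P_mono simp: le_fun_def)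
  qed
  with K that show thesis by blast
qed

text \<open>The proof of Dini's theorem, on the compact set provided by the exhaustion.\<close>

lemma Daniell:
  assumes f: "\<And>n. f n \<in> Lip_plus A" and dec: "\<And>n x. f (Suc n) x \<le> f n x"
    and null: "\<And>x e. 0 < e \<Longrightarrow> \<exists>n. f n x < e" and "0 < e"
  shows "\<exists>n. P (f n) < e"
proof -
  let ?d = "\<lambda>x. infdist x A"
  have d: "?d \<in> Lip_plus A" by (rule infdist_Lip_plus) simp
  obtain K where K: "compact K" "K \<subseteq> - A" and
    small: "\<And>g. g \<in> Lip_plus A \<Longrightarrow> (\<And>x. x \<in> K \<Longrightarrow> g x = 0) \<Longrightarrow> (\<And>x. g x \<le> f 0 x) \<Longrightarrow> P g < e / 2"
    using exhausted_compact[OF f[of 0], of "e / 2"] \<open>0 < e\<close> by auto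
  \<comment> \<open>The summand 1 keeps the denominator positive when \<open>P ?d = 0\<close>; the
    choice gives \<open>\<delta> * P ?d < e / 2\<close>.\<close>
  define \<delta> where "\<delta> = e / (2 * (P ?d + 1))"
  have Pd: "0 \<le> P ?d" using d by (rule P_nonneg)
  then have \<delta>: "0 < \<delta>" "\<delta> * P ?d < e / 2"
    using \<open>0 < e\<close> by (auto simp: \<delta>_def field_simps add_pos_nonneg)
  define U where "U n = {x. f n x < \<delta> * ?d x}" for n
  have "open (U n)" for n
    unfolding U_def by (intro open_Collect_less continuous_intros Lip_continuous_on[OF Lip_plus_imp_Lip[OF f]])
  moreover have "K \<subseteq> (\<Union>n. U n)"
  proof
    fix x assume "x \<in> K"
    then have "0 < \<delta> * ?d x" using K \<delta> infdist_A_pos by auto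
    from null[OF this] show "x \<in> (\<Union>n. U n)" by (auto simp: U_def)
  qed
  ultimately obtain I where I: "finite I" "K \<subseteq> (\<Union>n\<in>I. U n)"
    using compactE_image[OF K(1), of UNIV U] by auto
  have dec': "f n x \<le> f m x" if "m \<le> n" for m n x
    using that dec by (rule lift_Suc_antimono_le[of "\<lambda>n. f n x", rotated])
  obtain N where N: "\<And>n. n \<in> I \<Longrightarrow> n \<le> N" using I(1) finite_nat_set_iff_bounded_le by auto
  have K_le: "f N x \<le> \<delta> * ?d x" if "x \<in> K" for x
  proof -
    from that I obtain n where "n \<in> I" "f n x < \<delta> * ?d x" by (auto simp: U_def)
    then show ?thesis using dec'[OF N[of n], of x] by simp
  qed
  \<comment> \<open>\<open>f N\<close> is cut at the threshold: the lower part costs at most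
    \<open>\<delta> * P ?d\<close>, and the excess vanishes on \<open>K\<close> and lies below
    \<open>f 0\<close>, so the exhaustion bounds it by \<open>e / 2\<close>.\<close>
  let ?m = "\<lambda>x. min (f N x) (\<delta> * ?d x)"
  have \<delta>d: "(\<lambda>x. \<delta> * ?d x) \<in> Lip_plus A" using Lip_plus_cmult[OF d] \<delta> by simp
  then have "(\<lambda>x. \<delta> * ?d x) \<in> Lip_plus {}" using Lip_plus_antimono[of "{}" A] by blast
  then have m: "?m \<in> Lip_plus A" by (rule Lip_plus_min[OF f])
  have g: "(\<lambda>x. f N x - ?m x) \<in> Lip_plus A" using f m by (rule Lip_plus_diff) simp
  have "P (\<lambda>x. f N x - ?m x) < e / 2"
  proof (rule small[OF g])
    show "f N x - ?m x \<le> f 0 x" for x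
      using Lip_plus_nonneg[OF m, of x] dec'[of 0 N x] by linarith
  qed (use K_le in auto)
  moreover have "P ?m \<le> \<delta> * P ?d"
    using P_mono[OF m \<delta>d] P_cmult[OF Lip_plus_imp_Lip[OF d]] by simp
  ultimately have "P (f N) < e"
    using \<delta> P_diff[of "f N" ?m] f m by (simp add: Lip_plus_imp_Lip)
  then show ?thesis by blast
qed

text \<open>The deficits of the partial sums below \<open>g\<close> decrease to 0 everywhere, on
  \<open>A\<close> because \<open>g\<close> vanishes there, so \<open>Daniell\<close> makes their
  \<open>P\<close>-values small. This is what keeps the upper integral from falling below
  \<open>P\<close>.\<close>

lemma countably_subadditive_on_Lip:
  assumes g: "g \<in> Lip_plus A" and f: "\<And>n. f n \<in> Lip_plus A"
    and le: "\<And>x. x \<notin> A \<Longrightarrow> ennreal (g x) \<le> (\<Sum>n. ennreal (f n x))"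
  shows "ennreal (P g) \<le> (\<Sum>n. ennreal (P (f n)))"
proof (rule ennreal_le_epsilon)
  fix e :: real assume "0 < e"
  let ?s = "\<lambda>n x. \<Sum>k<n. f k x"
  have s: "?s n \<in> Lip_plus A" for n using f by (intro Lip_plus_sum)
  have m: "(\<lambda>x. min (g x) (?s n x)) \<in> Lip_plus A" for n
    using g s[of n] Lip_plus_antimono[of "{}" A] by (intro Lip_plus_min) auto
  define h where "h n x = g x - min (g x) (?s n x)" for n x
  have h: "h n \<in> Lip_plus A" for n
    unfolding h_def using g m by (rule Lip_plus_diff) simp
  have "\<exists>n. P (h n) < e"
  proof (rule Daniell[OF h _ _ \<open>0 < e\<close>])
    show "h (Suc n) x \<le> h n x" for n x
      using Lip_plus_nonneg[OF f, of n x] by (auto simp: h_def min_def)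
    show "\<exists>n. h n x < r" if "0 < r" for x r
    proof (cases "x \<in> A \<or> g x < r")
      \<comment> \<open>The empty partial sum suffices here, since
        \<open>h 0 x = g x\<close>.\<close>
      case True
      then have "h 0 x < r"
        using that Lip_zero_on[OF Lip_plus_imp_Lip[OF g], of x] Lip_plus_nonneg[OF g, of x]
        by (auto simp: h_def)
      then show ?thesis by blast
    next
      case False
      then have "ennreal (g x - r) < ennreal (g x)"
        using that by (intro ennreal_lessI) auto
      also have "\<dots> \<le> (SUP n. \<Sum>k<n. ennreal (f k x))"
        using False le by (simp add: suminf_eq_SUP)
      finally obtain n where "ennreal (g x - r) < (\<Sum>k<n. ennreal (f k x))"
        by (auto simp: less_SUP_iff)
      then have "g x - r < ?s n x"
        using False Lip_plus_nonneg[OF f] by (simp add: sum_ennreal ennreal_less_iff)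
      then show ?thesis using that by (intro exI[of _ n]) (auto simp: h_def)
    qed
  qed
  then obtain n where n: "P (h n) < e" by blast
  have "P g \<le> P (?s n) + P (h n)"
    using P_mono[OF g Lip_plus_add[OF s h, of n n]] P_add[OF Lip_plus_imp_Lip[OF s] Lip_plus_imp_Lip[OF h], of n n]
    by (auto simp: h_def)
  also have "P (?s n) = (\<Sum>k<n. P (f k))" using f by (rule P_sum)
  finally have "ennreal (P g) \<le> ennreal ((\<Sum>k<n. P (f k)) + e)"
    using n by (intro ennreal_leI) simp
  also have "\<dots> = (\<Sum>k<n. ennreal (P (f k))) + ennreal e"
    using P_nonneg[OF f] \<open>0 < e\<close> by (simp add: sum_nonneg sum_ennreal)
  also have "\<dots> \<le> (\<Sum>n. ennreal (P (f n))) + ennreal e"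
    by (intro add_right_mono sum_le_suminf) auto
  finally show "ennreal (P g) \<le> (\<Sum>n. ennreal (P (f n))) + ennreal e" .
qed

text \<open>The Daniell upper integral; domination is required off \<open>A\<close> only, which makes \<open>A\<close> a null set.\<close>

definition upper :: "('a \<Rightarrow> ennreal) \<Rightarrow> ennreal" where
  "upper F = (INF f\<in>{f. (\<forall>n. f n \<in> Lip_plus A) \<and>
     (\<forall>x. x \<notin> A \<longrightarrow> F x \<le> (\<Sum>n. ennreal (f n x)))}. \<Sum>n. ennreal (P (f n)))"

lemma upper_le:
  assumes "\<And>n. f n \<in> Lip_plus A" "\<And>x. x \<notin> A \<Longrightarrow> F x \<le> (\<Sum>n. ennreal (f n x))"
  shows "upper F \<le> (\<Sum>n. ennreal (P (f n)))"
  unfolding upper_def using assms by (intro INF_lower) auto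

lemma upper_greatest:
  assumes "\<And>f. (\<And>n. f n \<in> Lip_plus A) \<Longrightarrow> (\<And>x. x \<notin> A \<Longrightarrow> F x \<le> (\<Sum>n. ennreal (f n x))) \<Longrightarrow>
    c \<le> (\<Sum>n. ennreal (P (f n)))"
  shows "c \<le> upper F"
  unfolding upper_def using assms by (intro INF_greatest) auto

lemma upper_mono: "(\<And>x. x \<notin> A \<Longrightarrow> F x \<le> G x) \<Longrightarrow> upper F \<le> upper G"
  by (intro upper_greatest upper_le) (auto intro: order_trans)

text \<open>The cover consisting of \<open>f\<close> and zeros gives one inequality, countable
  subadditivity the other.\<close>

lemma upper_Lip:
  assumes "f \<in> Lip_plus A"
  shows "upper (\<lambda>x. ennreal (f x)) = ennreal (P f)"
proof (rule antisym)
  let ?f = "\<lambda>n::nat. if n = 0 then f else (\<lambda>x. 0)"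
  have s: "(\<Sum>n. h (?f n)) = h f" if "h (\<lambda>x. 0) = 0" for h :: "('a \<Rightarrow> real) \<Rightarrow> ennreal"
    using suminf_finite[of "{0}" "\<lambda>n. h (?f n)"] that by simp
  show "upper (\<lambda>x. ennreal (f x)) \<le> ennreal (P f)"
    using upper_le[of ?f "\<lambda>x. ennreal (f x)"] assms
      s[of "\<lambda>g. ennreal (P g)"] s[of "\<lambda>g. ennreal (g x)" for x]
    by (simp add: Lip_plus_zero P_zero)
  show "ennreal (P f) \<le> upper (\<lambda>x. ennreal (f x))"
    by (intro upper_greatest countably_subadditive_on_Lip[OF assms])
qed

lemma upper_zero: "upper (\<lambda>x. 0) = 0"
  using upper_Lip[OF Lip_plus_zero] by (simp add: P_zero)

text \<open>Covers of the \<open>F n\<close> that are optimal up to \<open>r n\<close>, with the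
  \<open>r n\<close> summing to \<open>e\<close>, are merged into one sequence by the pairing
  function.\<close>

lemma upper_suminf: "upper (\<lambda>x. \<Sum>n. F n x) \<le> (\<Sum>n. upper (F n))"
proof (rule ennreal_le_epsilon)
  fix e :: real assume fin: "(\<Sum>n. upper (F n)) < top" and e: "0 < e"
  define r where "r n = e * (1 / 2) ^ Suc n" for n
  have r: "0 < r n" for n using e by (simp add: r_def)
  have "r sums (e * 1)" unfolding r_def by (intro sums_mult power_half_series)
  then have rsum: "(\<Sum>n. ennreal (r n)) = ennreal e"
    using suminf_ennreal_eq[of r e, OF less_imp_le[OF r]] by simp
  have "\<exists>f. (\<forall>k. f k \<in> Lip_plus A) \<and> (\<forall>x. x \<notin> A \<longrightarrow> F n x \<le> (\<Sum>k. ennreal (f k x))) \<and>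
    (\<Sum>k. ennreal (P (f k))) < upper (F n) + ennreal (r n)" for n
  proof -
    have "upper (F n) \<le> (\<Sum>n. upper (F n))" using sum_le_suminf[of "\<lambda>n. upper (F n)" "{n}"] by simp
    \<comment> \<open>Finiteness makes adding \<open>r n\<close> a strict increase, so some cover
      stays below the enlarged value.\<close>
    then have "upper (F n) \<noteq> top" using fin by auto
    then have "upper (F n) < upper (F n) + ennreal (r n)"
      using r[of n] by (metis ennreal_add_left_cancel_less add.right_neutral ennreal_less_zero_iff infinity_ennreal_def)
    then show ?thesis unfolding upper_def[of "F n"] INF_less_iff by blast
  qed
  then obtain f where f: "\<And>n k. f n k \<in> Lip_plus A"
    and F: "\<And>n x. x \<notin> A \<Longrightarrow> F n x \<le> (\<Sum>k. ennreal (f n k x))"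
    and P: "\<And>n. (\<Sum>k. ennreal (P (f n k))) < upper (F n) + ennreal (r n)"
    by metis
  define g where "g i = case_prod f (prod_decode i)" for i
  have g: "(\<Sum>i. h (g i)) = (\<Sum>n. \<Sum>k. h (f n k))" for h :: "('a \<Rightarrow> real) \<Rightarrow> ennreal"
    unfolding g_def
    using suminf_ennreal_2dimen[of "\<lambda>n. \<Sum>k. h (f n k)" "\<lambda>p. h (case_prod f p)"] by simp
  have "upper (\<lambda>x. \<Sum>n. F n x) \<le> (\<Sum>i. ennreal (P (g i)))"
  proof (rule upper_le)
    show "g i \<in> Lip_plus A" for i using f by (simp add: g_def split: prod.split)
    show "(\<Sum>n. F n x) \<le> (\<Sum>i. ennreal (g i x))" if "x \<notin> A" for x
      unfolding g[of "\<lambda>h. ennreal (h x)"] using F[OF that] by (intro suminf_le) auto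
  qed
  also have "\<dots> \<le> (\<Sum>n. upper (F n) + ennreal (r n))"
    unfolding g[of "\<lambda>h. ennreal (P h)"] using P by (intro suminf_le) (auto intro: less_imp_le)
  also have "\<dots> = (\<Sum>n. upper (F n)) + ennreal e"
    using suminf_add[of "\<lambda>n. upper (F n)" "\<lambda>n. ennreal (r n)"] rsum by simp
  finally show "upper (\<lambda>x. \<Sum>n. F n x) \<le> (\<Sum>n. upper (F n)) + ennreal e" .
qed

lemma upper_add: "upper (\<lambda>x. F x + G x) \<le> upper F + upper G"
proof -
  let ?H = "\<lambda>n::nat. if n = 0 then F else if n = 1 then G else (\<lambda>x. 0)"
  have s: "(\<Sum>n. h (?H n)) = h F + h G" if "h (\<lambda>x. 0) = 0" for h :: "('a \<Rightarrow> ennreal) \<Rightarrow> ennreal"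
    using suminf_finite[of "{0, 1}" "\<lambda>n. h (?H n)"] that by simp
  show ?thesis
    using upper_suminf[of ?H] s[of upper] s[of "\<lambda>g. g x" for x] by (simp add: upper_zero)
qed

lemma upper_cmult_le:
  assumes "0 < c"
  shows "upper (\<lambda>x. ennreal c * F x) \<le> ennreal c * upper F"
proof -
  have "ennreal (1 / c) * upper (\<lambda>x. ennreal c * F x) \<le> upper F"
  proof (rule upper_greatest)
    fix f assume f: "\<And>n. f n \<in> Lip_plus A" "\<And>x. x \<notin> A \<Longrightarrow> F x \<le> (\<Sum>n. ennreal (f n x))"
    have "upper (\<lambda>x. ennreal c * F x) \<le> (\<Sum>n. ennreal (P (\<lambda>x. c * f n x)))"
    proof (rule upper_le)
      show "(\<lambda>x. c * f n x) \<in> Lip_plus A" for n using f assms by (intro Lip_plus_cmult) auto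
      show "ennreal c * F x \<le> (\<Sum>n. ennreal (c * f n x))" if "x \<notin> A" for x
        using f(2)[OF that] Lip_plus_nonneg[OF f(1)] assms
        by (simp add: ennreal_mult ennreal_suminf_cmult mult_left_mono)
    qed
    also have "\<dots> = ennreal c * (\<Sum>n. ennreal (P (f n)))"
      using P_nonneg[OF f(1)] assms Lip_plus_imp_Lip[OF f(1)]
      by (simp add: P_cmult ennreal_mult ennreal_suminf_cmult)
    finally have "ennreal (1 / c) * upper (\<lambda>x. ennreal c * F x) \<le>
        ennreal (1 / c) * (ennreal c * (\<Sum>n. ennreal (P (f n))))"
      by (intro mult_left_mono) auto
    also have "\<dots> = (\<Sum>n. ennreal (P (f n)))"
      using assms by (simp add: mult.assoc[symmetric] ennreal_mult[symmetric])
    finally show "ennreal (1 / c) * upper (\<lambda>x. ennreal c * F x) \<le> (\<Sum>n. ennreal (P (f n)))" .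
  qed
  then have "ennreal c * (ennreal (1 / c) * upper (\<lambda>x. ennreal c * F x)) \<le> ennreal c * upper F"
    by (intro mult_left_mono) auto
  then show ?thesis
    using assms by (simp add: mult.assoc[symmetric] ennreal_mult[symmetric])
qed

text \<open>The missing inequality is the other one applied to the factor
  \<open>1 / c\<close>.\<close>

lemma upper_cmult:
  assumes "0 < c"
  shows "upper (\<lambda>x. ennreal c * F x) = ennreal c * upper F"
proof (rule antisym[OF upper_cmult_le[OF assms]])
  have *: "ennreal (1 / c) * (ennreal c * y) = y" "ennreal c * (ennreal (1 / c) * y) = y" for y
    using assms by (simp_all add: mult.assoc[symmetric] ennreal_mult[symmetric])
  have "upper F \<le> ennreal (1 / c) * upper (\<lambda>x. ennreal c * F x)"
    using upper_cmult_le[of "1 / c" "\<lambda>x. ennreal c * F x"] assms by (simp add: *)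
  then have "ennreal c * upper F \<le> ennreal c * (ennreal (1 / c) * upper (\<lambda>x. ennreal c * F x))"
    by (intro mult_left_mono) auto
  then show "ennreal c * upper F \<le> upper (\<lambda>x. ennreal c * F x)" by (simp add: *)
qed

text \<open>The increments of the sequence are themselves a cover of its supremum, and their
  \<open>P\<close>-values telescope.\<close>

lemma upper_SUP:
  assumes u: "\<And>k. u k \<in> Lip_plus A" and inc: "\<And>k x. u k x \<le> u (Suc k) x"
  shows "upper (\<lambda>x. SUP k. ennreal (u k x)) \<le> (SUP k. ennreal (P (u k)))"
proof -
  define d where "d k = (case k of 0 \<Rightarrow> u 0 | Suc j \<Rightarrow> (\<lambda>x. u (Suc j) x - u j x))" for k
  have d: "d k \<in> Lip_plus A" for k
    using u inc by (auto simp: d_def split: nat.split intro: Lip_plus_diff)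
  have part: "(\<Sum>k<Suc n. d k x) = u n x" for n x
    by (induction n) (simp_all add: d_def)
  have "upper (\<lambda>x. SUP k. ennreal (u k x)) \<le> (\<Sum>k. ennreal (P (d k)))"
  proof (rule upper_le[OF d], rule SUP_least)
    fix x k
    have "ennreal (u k x) = (\<Sum>k<Suc k. ennreal (d k x))"
      unfolding part[symmetric] using Lip_plus_nonneg[OF d] by (intro sum_ennreal[symmetric]) auto
    also have "\<dots> \<le> (\<Sum>k. ennreal (d k x))" by (intro sum_le_suminf) auto
    finally show "ennreal (u k x) \<le> (\<Sum>k. ennreal (d k x))" .
  qed
  also have "\<dots> \<le> (SUP k. ennreal (P (u k)))"
    unfolding suminf_eq_SUP
  proof (rule SUP_least)
    fix n
    \<comment> \<open>One more term is added because the first \<open>Suc n\<close> increments sum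
      to \<open>u n\<close>.\<close>
    have "(\<Sum>k<n. ennreal (P (d k))) \<le> (\<Sum>k<Suc n. ennreal (P (d k)))" by simp
    also have "\<dots> = ennreal (\<Sum>k<Suc n. P (d k))"
      using P_nonneg[OF d] by (intro sum_ennreal) auto
    also have "(\<Sum>k<Suc n. P (d k)) = P (u n)"
      unfolding part[symmetric] using d by (intro P_sum[symmetric])
    finally show "(\<Sum>k<n. ennreal (P (d k))) \<le> (SUP k. ennreal (P (u k)))"
      by (rule order_trans) (intro SUP_upper, simp)
  qed
  finally show ?thesis .
qed

lemma Lip_plus_min_infdist:
  assumes "f \<in> Lip_plus A"
  shows "(\<lambda>x. min (f x) (real k * infdist x C)) \<in> Lip_plus A"
  using assms Lip_plus_cmult[OF infdist_Lip_plus[of "{}" C], of "real k"] by (intro Lip_plus_min) auto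

text \<open>This is Caratheodory's criterion for open sets. Each covering function is cut into
  \<open>u n k\<close>, which increases to it on \<open>U - A\<close>, and a remainder, which still
  equals it off \<open>U\<close> because \<open>u n k\<close> vanishes there. Hence the two pieces
  cover the two parts of \<open>F\<close>, and their \<open>P\<close>-values add up to the original
  ones.\<close>

lemma upper_split:
  assumes U: "open U"
  shows "upper (\<lambda>x. F x * indicator U x) + upper (\<lambda>x. F x * indicator (- U) x) \<le> upper F"
proof (rule upper_greatest)
  fix f assume f: "\<And>n. f n \<in> Lip_plus A" and F: "\<And>x. x \<notin> A \<Longrightarrow> F x \<le> (\<Sum>n. ennreal (f n x))"
  \<comment> \<open>Joining \<open>A\<close> keeps the set nonempty even for
    \<open>U = UNIV\<close>, where the distance to the empty set would be the default value 0;
    covers are tested only off \<open>A\<close>, so nothing is lost.\<close>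
  let ?C = "- U \<union> A"
  have C: "closed ?C" "?C \<noteq> {}" using U closed_A A_nonempty by auto
  define u where "u n k x = min (f n x) (real k * infdist x ?C)" for n k x
  have u: "u n k \<in> Lip_plus A" for n k unfolding u_def by (rule Lip_plus_min_infdist[OF f])
  have inc: "u n k x \<le> u n (Suc k) x" for n k x
    unfolding u_def by (intro min.mono mult_right_mono) (auto simp: infdist_nonneg)
  have diff: "(\<lambda>x. f n x - u n k x) \<in> Lip_plus A" for n k
    using f u by (rule Lip_plus_diff) (simp add: u_def)
  have "upper (\<lambda>x. F x * indicator U x) \<le> upper (\<lambda>x. \<Sum>n. SUP k. ennreal (u n k x))"
  proof (rule upper_mono)
    fix x assume "x \<notin> A"
    have "F x * indicator U x \<le> (\<Sum>n. ennreal (f n x)) * indicator U x"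
      using F[OF \<open>x \<notin> A\<close>] by (rule mult_right_mono) simp
    also have "\<dots> = (\<Sum>n. ennreal (f n x) * indicator (- ?C) x)"
      using \<open>x \<notin> A\<close> by (simp split: split_indicator)
    also have "\<dots> = (\<Sum>n. SUP k. ennreal (u n k x))"
      unfolding u_def using Lip_plus_nonneg[OF f] by (simp add: min_infdist_SUP[OF C])
    finally show "F x * indicator U x \<le> (\<Sum>n. SUP k. ennreal (u n k x))" .
  qed
  also have "\<dots> \<le> (\<Sum>n. upper (\<lambda>x. SUP k. ennreal (u n k x)))" by (rule upper_suminf)
  also have "\<dots> \<le> (\<Sum>n. SUP k. ennreal (P (u n k)))"
    by (intro suminf_le upper_SUP u inc) auto
  also have "\<dots> = (SUP k. \<Sum>n. ennreal (P (u n k)))"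
    by (intro ennreal_suminf_SUP_eq incseq_SucI ennreal_leI P_mono u inc)
  finally have "upper (\<lambda>x. F x * indicator U x) + upper (\<lambda>x. F x * indicator (- U) x) \<le>
      (SUP k. \<Sum>n. ennreal (P (u n k))) + upper (\<lambda>x. F x * indicator (- U) x)"
    by (rule add_right_mono)
  \<comment> \<open>With the second summand inside the supremum, it can be estimated by the
    remainders belonging to the same \<open>k\<close>.\<close>
  also have "\<dots> = (SUP k. (\<Sum>n. ennreal (P (u n k))) + upper (\<lambda>x. F x * indicator (- U) x))"
    by (rule ennreal_SUP_add_left[symmetric]) simp
  also have "\<dots> \<le> (\<Sum>n. ennreal (P (f n)))"
  proof (rule SUP_least)
    fix k
    have "upper (\<lambda>x. F x * indicator (- U) x) \<le> (\<Sum>n. ennreal (P (\<lambda>x. f n x - u n k x)))"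
    proof (rule upper_le[OF diff])
      show "F x * indicator (- U) x \<le> (\<Sum>n. ennreal (f n x - u n k x))" if "x \<notin> A" for x
        using F[OF that] Lip_plus_nonneg[OF f] by (simp add: u_def min_absorb2 split: split_indicator)
    qed
    then have "(\<Sum>n. ennreal (P (u n k))) + upper (\<lambda>x. F x * indicator (- U) x) \<le>
      (\<Sum>n. ennreal (P (u n k))) + (\<Sum>n. ennreal (P (\<lambda>x. f n x - u n k x)))"
      by (rule add_left_mono)
    also have "\<dots> = (\<Sum>n. ennreal (P (u n k)) + ennreal (P (\<lambda>x. f n x - u n k x)))"
      by (rule suminf_add) auto
    also have "\<dots> = (\<Sum>n. ennreal (P (f n)))"
    proof (intro suminf_cong)
      fix n
      have "P (f n) = P (u n k) + P (\<lambda>x. f n x - u n k x)"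
        using P_diff[of "f n" "u n k"] f u by (simp add: Lip_plus_imp_Lip)
      then show "ennreal (P (u n k)) + ennreal (P (\<lambda>x. f n x - u n k x)) = ennreal (P (f n))"
        using P_nonneg[OF u] P_nonneg[OF diff] by (simp add: ennreal_plus)
    qed
    finally show "(\<Sum>n. ennreal (P (u n k))) + upper (\<lambda>x. F x * indicator (- U) x)
      \<le> (\<Sum>n. ennreal (P (f n)))" .
  qed
  finally show "upper (\<lambda>x. F x * indicator U x) + upper (\<lambda>x. F x * indicator (- U) x)
    \<le> (\<Sum>n. ennreal (P (f n)))" .
qed

section \<open>Caratheodory's construction of the representing measure\<close>

definition rep_measure :: "'a measure" where
  "rep_measure = measure_of UNIV (sets borel) (\<lambda>E. upper (indicator E))"

lemma sets_rep_measure [measurable_cong, simp]: "sets rep_measure = sets borel"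
  unfolding rep_measure_def using sets.sets_measure_of_eq[of borel] by simp

text \<open>\<open>measure_of\<close> has the prescribed values only if these form a measure. The
  upper integral of indicators is an outer measure, its Caratheodory-measurable sets form a
  sigma-algebra, and by \<open>upper_split\<close> this contains the open sets, hence all Borel
  sets.\<close>

lemma emeasure_rep_measure:
  assumes E: "E \<in> sets borel"
  shows "emeasure rep_measure E = upper (indicator E)"
proof -
  let ?m = "\<lambda>E. upper (indicator E)"
  have outer: "outer_measure_space (Pow UNIV) ?m"
    unfolding outer_measure_space_def positive_def increasing_def countably_subadditive_def
  proof (intro conjI ballI allI impI)
    show "?m {} = 0" using upper_zero by (simp add: indicator_def[abs_def])
    show "?m X \<le> ?m Y" if "X \<subseteq> Y" for X Y
      using that by (intro upper_mono) (auto split: split_indicator)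
    show "?m (\<Union>i. E i) \<le> (\<Sum>i. ?m (E i))" for E :: "nat \<Rightarrow> 'a set"
    proof (rule order_trans[OF upper_mono upper_suminf])
      show "indicator (\<Union>i. E i) x \<le> (\<Sum>i. indicator (E i) x :: ennreal)" for x
      proof (cases "x \<in> (\<Union>i. E i)")
        case True
        then obtain i where "x \<in> E i" by auto
        then show ?thesis
          using True sum_le_suminf[of "\<lambda>i. indicator (E i) x :: ennreal" "{i}"] by simp
      qed simp
    qed
  qed
  let ?L = "lambda_system UNIV (Pow UNIV) ?m"
  have L: "measure_space UNIV ?L ?m"
    by (rule sigma_algebra.caratheodory_lemma[OF sigma_algebra_Pow outer])
  have "U \<in> ?L" if "open U" for U :: "'a set"
    unfolding lambda_system_def
  proof (intro CollectI conjI ballI)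
    fix X :: "'a set"
    have i: "indicator (V \<inter> X) x = (indicator X x * indicator V x :: ennreal)" for V x
      by (simp split: split_indicator)
    have "?m X \<le> ?m (U \<inter> X) + ?m (- U \<inter> X)"
      using upper_mono upper_add
      by (rule order_trans) (simp split: split_indicator)
    moreover have "?m (U \<inter> X) + ?m (- U \<inter> X) \<le> ?m X"
      using upper_split[OF that, of "indicator X"] by (simp add: i[abs_def])
    ultimately show "?m (U \<inter> X) + ?m ((UNIV - U) \<inter> X) = ?m X"
      by (simp add: Compl_eq_Diff_UNIV)
  qed simp
  then have "sets borel \<subseteq> ?L"
    using sigma_algebra.sigma_sets_subset[of UNIV ?L "{S. open S}"] L
    by (auto simp: measure_space_def borel_def)
  then have "measure_space UNIV (sets borel) ?m"
    using measure_down[OF L, of "sets borel"] sets.sigma_algebra_axioms[of "borel :: 'a measure"]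
    by simp
  then show ?thesis
    using E by (intro emeasure_measure_of[OF rep_measure_def]) (auto simp: measure_space_def)
qed

end

section \<open>Layer sums and the integrals of Lipschitz functions\<close>

text \<open>The levels \<open>e\<close>, \<open>2 * e\<close>, ... not exceeding \<open>y\<close>
  number floor of \<open>y / e\<close>, so the sum is \<open>y\<close> rounded down to a multiple of
  \<open>e\<close>. Starting at \<open>e\<close> and not at 0 keeps it below
  \<open>y\<close>.\<close>

lemma layer_sum:
  assumes "0 < e" "0 \<le> y"
  shows "ennreal (y - e) \<le> (\<Sum>j. ennreal e * indicator {real (Suc j) * e..} y)"
    and "(\<Sum>j. ennreal e * indicator {real (Suc j) * e..} y) \<le> ennreal y"
proof -
  define n where "n = nat \<lfloor>y / e\<rfloor>"
  have "real n = of_int \<lfloor>y / e\<rfloor>" using assms by (simp add: n_def)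
  then have "real n \<le> y / e" "y / e < real (Suc n)"
    using floor_correct[of "y / e"] by linarith+
  then have n: "real n * e \<le> y" "y < real (Suc n) * e"
    using assms by (simp_all only: pos_le_divide_eq pos_divide_less_eq)
  have "real (Suc j) * e \<le> y \<longleftrightarrow> j < n" for j
  proof
    assume "real (Suc j) * e \<le> y"
    then have "real (Suc j) * e < real (Suc n) * e" using n by simp
    then show "j < n" using assms by simp
  next
    assume "j < n"
    then have "real (Suc j) * e \<le> real n * e" using assms by (intro mult_right_mono) auto
    then show "real (Suc j) * e \<le> y" using n by simp
  qed
  then have "(\<Sum>j. ennreal e * indicator {real (Suc j) * e..} y) = (\<Sum>j<n. ennreal e)"
    by (subst suminf_finite[of "{..<n}"]) auto
  also have "\<dots> = ennreal (real n * e)"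
    using assms by (simp add: ennreal_mult ennreal_of_nat_eq_real_of_nat)
  finally have "(\<Sum>j. ennreal e * indicator {real (Suc j) * e..} y) = ennreal (real n * e)" .
  then show "ennreal (y - e) \<le> (\<Sum>j. ennreal e * indicator {real (Suc j) * e..} y)"
    "(\<Sum>j. ennreal e * indicator {real (Suc j) * e..} y) \<le> ennreal y"
    using n by (auto intro!: ennreal_leI simp: algebra_simps)
qed

context exhausted_functional
begin

text \<open>A Chebyshev estimate for each slab: the part of \<open>f\<close> between heights
  \<open>j * e\<close> and \<open>Suc j * e\<close> is a Lipschitz function equal to
  \<open>e\<close> on the superlevel set. The \<open>P\<close>-values of the slabs telescope to that
  of a truncation of \<open>f\<close>.\<close>

lemma superlevel_sum_le:
  assumes f: "f \<in> Lip_plus A" and e: "0 < e"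
  shows "(\<Sum>j. ennreal e * upper (indicator {x. real (Suc j) * e \<le> f x})) \<le> ennreal (P f)"
  unfolding suminf_eq_SUP
proof (rule SUP_least)
  fix n
  define g where "g j x = min (f x) (real j * e)" for j x
  have g: "g j \<in> Lip_plus A" for j
    unfolding g_def using e by (intro Lip_plus_min f Lip_plus_const) auto
  have mono: "g j x \<le> g (Suc j) x" for j x
    unfolding g_def using e by (intro min.mono mult_right_mono) auto
  have s: "(\<lambda>x. g (Suc j) x - g j x) \<in> Lip_plus A" for j
    using g g mono by (rule Lip_plus_diff)
  have "(\<Sum>j<n. ennreal e * upper (indicator {x. real (Suc j) * e \<le> f x})) \<le>
    (\<Sum>j<n. ennreal (P (g (Suc j)) - P (g j)))"
  proof (rule sum_mono)
    fix j
    have "ennreal e * upper (indicator {x. real (Suc j) * e \<le> f x}) =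
        upper (\<lambda>x. ennreal e * indicator {x. real (Suc j) * e \<le> f x} x)"
      by (rule upper_cmult[OF e, symmetric])
    also have "\<dots> \<le> upper (\<lambda>x. ennreal (g (Suc j) x - g j x))"
    proof (rule upper_mono)
      fix x
      show "ennreal e * indicator {x. real (Suc j) * e \<le> f x} x \<le> ennreal (g (Suc j) x - g j x)"
      proof (cases "real (Suc j) * e \<le> f x")
        case True
        moreover have "real j * e \<le> real (Suc j) * e" using e by (intro mult_right_mono) auto
        ultimately have "g (Suc j) x - g j x = e"
          unfolding g_def by (simp add: min_absorb2 algebra_simps)
        then show ?thesis by (simp split: split_indicator)
      qed simp
    qed
    also have "\<dots> = ennreal (P (g (Suc j)) - P (g j))"
      using upper_Lip[OF s] P_diff[OF Lip_plus_imp_Lip[OF g] Lip_plus_imp_Lip[OF g]] by simp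
    finally show "ennreal e * upper (indicator {x. real (Suc j) * e \<le> f x}) \<le>
      ennreal (P (g (Suc j)) - P (g j))" .
  qed
  also have "\<dots> = ennreal (\<Sum>j<n. P (g (Suc j)) - P (g j))"
    using P_mono[OF g g mono] by (intro sum_ennreal) auto
  also have "(\<Sum>j<n. P (g (Suc j)) - P (g j)) = P (g n)"
  proof -
    have "g 0 = (\<lambda>x. 0)" using Lip_plus_nonneg[OF f] by (auto simp: g_def)
    then show ?thesis by (simp add: sum_lessThan_telescope[of "\<lambda>j. P (g j)"] P_zero)
  qed
  also have "P (g n) \<le> P f" by (intro P_mono g f) (simp add: g_def)
  finally show "(\<Sum>j<n. ennreal e * upper (indicator {x. real (Suc j) * e \<le> f x})) \<le> ennreal (P f)"
    by (simp add: ennreal_leI)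
qed

lemma nn_integral_layer_sum:
  assumes f: "f \<in> Lip A"
  shows "(\<integral>\<^sup>+x. (\<Sum>j. ennreal e * indicator {real (Suc j) * e..} (f x)) \<partial>rep_measure) =
    (\<Sum>j. ennreal e * upper (indicator {x. real (Suc j) * e \<le> f x}))"
proof -
  have E: "{x. real (Suc j) * e \<le> f x} \<in> sets borel" for j
    using Lip_borel_measurable[OF f] by measurable
  have "(\<Sum>j. ennreal e * indicator {real (Suc j) * e..} (f x)) =
    (\<Sum>j. ennreal e * indicator {x. real (Suc j) * e \<le> f x} x)" for x
    by (intro suminf_cong) (auto split: split_indicator)
  then show ?thesis
    using E by (simp add: nn_integral_suminf nn_integral_cmult_indicator emeasure_rep_measure
      del: ennreal_suminf_cmult of_nat_Suc)
qed

text \<open>Layer sums of step \<open>e\<close> lie between \<open>f - e\<close> and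
  \<open>f\<close>. The upper bound follows by monotone convergence as \<open>e\<close> tends to 0.
  For the lower bound a constant cannot be subtracted, since the total mass may be infinite;
  \<open>min f e\<close> is subtracted instead.\<close>

lemma nn_integral_rep_measure:
  assumes f: "f \<in> Lip_plus A"
  shows "(\<integral>\<^sup>+x. ennreal (f x) \<partial>rep_measure) = ennreal (P f)"
proof (rule antisym)
  let ?G = "\<lambda>e x. \<Sum>j. ennreal e * indicator {real (Suc j) * e..} (f x)"
  have f_Lip: "f \<in> Lip A" using f by (rule Lip_plus_imp_Lip)
  have [measurable]: "f \<in> borel_measurable borel" using f_Lip by (rule Lip_borel_measurable)
  note G = layer_sum[OF _ Lip_plus_nonneg[OF f]]
  have lim: "(SUP n. ennreal (f x - inverse (real (Suc n)))) = ennreal (f x)" for x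
  proof (rule LIMSEQ_unique[OF LIMSEQ_SUP])
    show "incseq (\<lambda>n. ennreal (f x - inverse (real (Suc n))))"
      by (intro incseq_SucI ennreal_leI) (simp add: field_simps)
    show "(\<lambda>n. ennreal (f x - inverse (real (Suc n)))) \<longlonglongrightarrow> ennreal (f x)"
      by (intro tendsto_ennrealI) (use LIMSEQ_inverse_real_of_nat_add_minus[of "f x"] in simp)
  qed
  have "(\<integral>\<^sup>+x. ennreal (f x) \<partial>rep_measure) =
      (\<integral>\<^sup>+x. (SUP n. ennreal (f x - inverse (real (Suc n)))) \<partial>rep_measure)"
    by (simp only: lim)
  also have "\<dots> = (SUP n. \<integral>\<^sup>+x. ennreal (f x - inverse (real (Suc n))) \<partial>rep_measure)"
    by (intro nn_integral_monotone_convergence_SUP)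
      (auto intro!: incseq_SucI le_funI ennreal_leI simp: field_simps)
  also have "\<dots> \<le> ennreal (P f)"
  proof (rule SUP_least)
    fix n
    let ?e = "inverse (real (Suc n))"
    have "(\<integral>\<^sup>+x. ennreal (f x - ?e) \<partial>rep_measure) \<le> (\<integral>\<^sup>+x. ?G ?e x \<partial>rep_measure)"
      by (intro nn_integral_mono G) simp
    also have "\<dots> \<le> ennreal (P f)"
      unfolding nn_integral_layer_sum[OF f_Lip] by (intro superlevel_sum_le f) simp
    finally show "(\<integral>\<^sup>+x. ennreal (f x - ?e) \<partial>rep_measure) \<le> ennreal (P f)" .
  qed
  finally show "(\<integral>\<^sup>+x. ennreal (f x) \<partial>rep_measure) \<le> ennreal (P f)" .
  show "ennreal (P f) \<le> (\<integral>\<^sup>+x. ennreal (f x) \<partial>rep_measure)"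
  proof (rule ennreal_le_epsilon)
    fix r :: real assume r: "0 < r"
    define g where "g n x = min (f x) (inverse (real (Suc n)))" for n x
    have g: "g n \<in> Lip_plus A" for n
      unfolding g_def by (intro Lip_plus_min f Lip_plus_const) auto
    have h: "(\<lambda>x. f x - g n x) \<in> Lip_plus A" for n
      using f g by (rule Lip_plus_diff) (simp add: g_def)
    \<comment> \<open>The truncations decrease to 0 uniformly, but without a finite total mass it
      takes \<open>Daniell\<close> to make their \<open>P\<close>-values small.\<close>
    have "\<exists>n. P (g n) < r"
    proof (rule Daniell[OF g _ _ r])
      show "g (Suc n) x \<le> g n x" for n x
        unfolding g_def by (intro min.mono) (auto simp: field_simps)
      show "\<exists>n. g n x < s" if "0 < s" for s x
        using reals_Archimedean[OF that] by (auto simp: g_def min_less_iff_disj)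
    qed
    then obtain n where n: "P (g n) < r" by blast
    let ?e = "inverse (real (Suc n))"
    have "ennreal (P (\<lambda>x. f x - g n x)) = upper (\<lambda>x. ennreal (f x - g n x))"
      using upper_Lip[OF h] by simp
    also have "\<dots> \<le> upper (?G ?e)"
    proof (rule upper_mono)
      fix x
      \<comment> \<open>Where \<open>f x < ?e\<close> both sides are 0, because
        \<open>ennreal\<close> sends negative reals to 0.\<close>
      have "ennreal (f x - g n x) = ennreal (f x - ?e)"
        by (auto simp: g_def min_def ennreal_neg)
      also have "\<dots> \<le> ?G ?e x" by (intro G) simp
      finally show "ennreal (f x - g n x) \<le> ?G ?e x" .
    qed
    also have "\<dots> \<le> (\<Sum>j. upper (\<lambda>x. ennreal ?e * indicator {real (Suc j) * ?e..} (f x)))"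
      by (rule upper_suminf)
    also have "\<dots> = (\<Sum>j. ennreal ?e * upper (indicator {x. real (Suc j) * ?e \<le> f x}))"
    proof (intro suminf_cong)
      fix j
      have "(\<lambda>x. indicator {real (Suc j) * ?e..} (f x)) = (indicator {x. real (Suc j) * ?e \<le> f x} :: 'a \<Rightarrow> ennreal)"
        by (auto simp: fun_eq_iff split: split_indicator)
      then show "upper (\<lambda>x. ennreal ?e * indicator {real (Suc j) * ?e..} (f x)) =
        ennreal ?e * upper (indicator {x. real (Suc j) * ?e \<le> f x})"
        using upper_cmult[of ?e "\<lambda>x. indicator {real (Suc j) * ?e..} (f x)"] by simp
    qed
    also have "\<dots> = (\<integral>\<^sup>+x. ?G ?e x \<partial>rep_measure)"
      unfolding nn_integral_layer_sum[OF f_Lip] ..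
    also have "\<dots> \<le> (\<integral>\<^sup>+x. ennreal (f x) \<partial>rep_measure)"
      by (intro nn_integral_mono G) simp
    finally have *: "ennreal (P (\<lambda>x. f x - g n x)) \<le> (\<integral>\<^sup>+x. ennreal (f x) \<partial>rep_measure)" .
    have "ennreal (P f) = ennreal (P (\<lambda>x. f x - g n x) + P (g n))"
      using P_diff[of f "g n"] f g by (simp add: Lip_plus_imp_Lip)
    also have "\<dots> = ennreal (P (\<lambda>x. f x - g n x)) + ennreal (P (g n))"
      by (intro ennreal_plus P_nonneg g h)
    also have "\<dots> \<le> (\<integral>\<^sup>+x. ennreal (f x) \<partial>rep_measure) + ennreal r"
      using n by (intro add_mono * ennreal_leI) simp
    finally show "ennreal (P f) \<le> (\<integral>\<^sup>+x. ennreal (f x) \<partial>rep_measure) + ennreal r" .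
  qed
qed

end

section \<open>Tightness\<close>

text \<open>The sets with such approximations form a sigma-algebra. It contains each closed set,
  whose open neighbourhoods of radius \<open>1 / (n + 1)\<close> shrink to it.\<close>

lemma closed_open_approximation:
  fixes N :: "'a::metric_space measure"
  assumes "finite_measure N" and sets_N: "sets N = sets borel" and "E \<in> sets borel" and "0 < e"
  shows "\<exists>C U. closed C \<and> open U \<and> C \<subseteq> E \<and> E \<subseteq> U \<and> measure N (U - C) < e"
proof -
  interpret finite_measure N by fact
  have [simp]: "closed S \<Longrightarrow> S \<in> sets N" "open S \<Longrightarrow> S \<in> sets N" for S
    by (simp_all add: sets_N)
  have "E \<in> sigma_sets UNIV (Collect closed)"
    using assms(3) unfolding borel_eq_closed by simp
  then show ?thesis using \<open>0 < e\<close>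
  proof (induction arbitrary: e)
    case (Basic F)
    then have F: "closed F" by simp
    show ?case
    \<comment> \<open>The distance to the empty set is 0 by default, so its neighbourhoods would not
      shrink.\<close>
    proof (cases "F = {}")
      case True
      then show ?thesis using Basic by (intro exI[of _ "{}"]) auto
    next
      case False
      define U where "U n = {x. infdist x F < inverse (real (Suc n))}" for n
      have U: "open (U n)" "F \<subseteq> U n" for n
        unfolding U_def by (auto intro!: open_Collect_less continuous_intros)
      have "(\<lambda>n. measure N (U n - F)) \<longlonglongrightarrow> measure N (\<Inter>n. U n - F)"
      proof (rule finite_Lim_measure_decseq)
        show "range (\<lambda>n. U n - F) \<subseteq> sets N" using U F by (auto intro: sets.Diff)
        show "decseq (\<lambda>n. U n - F)"
        proof (rule decseq_SucI)
          fix n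
          have "inverse (real (Suc (Suc n))) \<le> inverse (real (Suc n))" by (simp add: field_simps)
          then show "U (Suc n) - F \<subseteq> U n - F"
            unfolding U_def by (blast intro: less_le_trans)
        qed
      qed
      moreover have "(\<Inter>n. U n - F) = {}"
      proof (rule ccontr)
        assume "(\<Inter>n. U n - F) \<noteq> {}"
        then obtain x where x: "\<And>n. infdist x F < inverse (real (Suc n))" "x \<notin> F"
          by (auto simp: U_def)
        then have "0 < infdist x F" using F False infdist_pos_not_in_closed by auto
        then show False using reals_Archimedean x(1) less_asym by blast
      qed
      ultimately have "(\<lambda>n. measure N (U n - F)) \<longlonglongrightarrow> 0" by (simp only: measure_empty)
      then have "\<forall>\<^sub>F n in sequentially. measure N (U n - F) < e"
        using Basic(2) by (rule order_tendstoD(2))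
      then obtain n where "measure N (U n - F) < e" by (auto simp: eventually_sequentially)
      then show ?thesis using U[of n] F by blast
    qed
  next
    case Empty
    then show ?case by (intro exI[of _ "{}"]) auto
  next
    case (Compl E)
    then obtain C U where "closed C" "open U" "C \<subseteq> E" "E \<subseteq> U" "measure N (U - C) < e" by metis
    moreover have "- C - - U = U - C" by auto
    ultimately show ?case by (intro exI[of _ "- U"] exI[of _ "- C"]) auto
  next
    case (Union E)
    \<comment> \<open>Half of \<open>e\<close> is spent on the individual sets. The other half pays
      for replacing the union of the \<open>C k\<close>, which need not be closed, by a finite
      one.\<close>
    define r where "r n = (e / 2) * (1 / 2) ^ Suc n" for n
    have r: "0 < r n" for n using Union.prems by (simp add: r_def)
    have r_sums: "r sums (e / 2 * 1)" unfolding r_def by (intro sums_mult power_half_series)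
    have "\<forall>n. \<exists>C U. closed C \<and> open U \<and> C \<subseteq> E n \<and> E n \<subseteq> U \<and> measure N (U - C) < r n"
      using Union.IH r by blast
    then obtain C U where CU: "\<And>n. closed (C n) \<and> open (U n) \<and> C n \<subseteq> E n \<and> E n \<subseteq> U n \<and>
      measure N (U n - C n) < r n"
      by metis
    let ?U = "\<Union>n. U n" and ?C = "\<lambda>n. \<Union>k\<le>n. C k"
    have cl: "closed (?C n)" for n using CU by auto
    have op: "open ?U" using CU by auto
    have D: "U n - C n \<in> sets N" for n using CU by (intro sets.Diff) auto
    have summ: "summable (\<lambda>n. measure N (U n - C n))"
      by (rule summable_comparison_test'[OF sums_summable[OF r_sums]]) (use CU in \<open>simp add: less_imp_le\<close>)
    have "(\<lambda>n. measure N (?U - ?C n)) \<longlonglongrightarrow> measure N (\<Inter>n. ?U - ?C n)"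
    proof (rule finite_Lim_measure_decseq)
      show "range (\<lambda>n. ?U - ?C n) \<subseteq> sets N" using op cl by (auto intro: sets.Diff)
      show "decseq (\<lambda>n. ?U - ?C n)" by (rule decseq_SucI) (auto simp: atMost_Suc)
    qed
    moreover have "measure N (\<Inter>n. ?U - ?C n) < e"
    proof -
      have "measure N (\<Inter>n. ?U - ?C n) \<le> measure N (\<Union>n. U n - C n)"
        using D by (intro finite_measure_mono) auto
      also have "\<dots> \<le> (\<Sum>n. measure N (U n - C n))"
        using D summ by (intro finite_measure_subadditive_countably) auto
      also have "\<dots> \<le> (\<Sum>n. r n)"
        using CU summ r_sums by (intro suminf_le) (auto simp: less_imp_le sums_iff)
      also have "\<dots> = e / 2" using r_sums by (simp add: sums_iff)
      finally show ?thesis using Union.prems by simp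
    qed
    ultimately have "\<forall>\<^sub>F n in sequentially. measure N (?U - ?C n) < e"
      by (rule order_tendstoD(2))
    then obtain n where "measure N (?U - ?C n) < e" by (auto simp: eventually_sequentially)
    then show ?case
      using cl op CU by (intro exI[of _ "?C n"] exI[of _ ?U]) blast
  qed
qed

text \<open>A closed inner approximation is intersected with a compact set that carries all but
  \<open>e / 2\<close> of the mass.\<close>

lemma compact_inner_approximation:
  fixes N :: "'a::metric_space measure"
  assumes "finite_measure N" and sets_N: "sets N = sets borel" and E: "E \<in> sets borel" and "0 < e"
    and tight: "\<And>e. 0 < e \<Longrightarrow> \<exists>K. compact K \<and> measure N (- K) < e"
  obtains K where "compact K" "K \<subseteq> E" "measure N (E - K) < e"
proof -
  interpret finite_measure N by fact
  obtain C U where C: "closed C" "open U" "C \<subseteq> E" "E \<subseteq> U" "measure N (U - C) < e / 2"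
    using closed_open_approximation[OF assms(1-3), of "e / 2"] \<open>0 < e\<close> by auto
  obtain K where K: "compact K" "measure N (- K) < e / 2"
    using tight[of "e / 2"] \<open>0 < e\<close> by auto
  have s: "U - C \<in> sets N" "- K \<in> sets N" "E - K \<inter> C \<in> sets N"
    using C K E by (auto simp: sets_N compact_imp_closed intro!: sets.Diff)
  have "measure N (E - K \<inter> C) \<le> measure N ((U - C) \<union> - K)"
    using C s by (intro finite_measure_mono) auto
  also have "\<dots> \<le> measure N (U - C) + measure N (- K)"
    using s by (intro measure_Un_le)
  finally have "measure N (E - K \<inter> C) < e" using C K by simp
  moreover have "compact (K \<inter> C)" using K C by (intro compact_Int_closed)
  ultimately show thesis using that[of "K \<inter> C"] C by auto
qed

text \<open>\<open>M\<close> may be infinite near \<open>A\<close>, so the approximation is done for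
  the finite measure \<open>N\<close>. On the slice \<open>F n\<close> the density is at least
  \<open>1 / (n + 1)\<close>, which bounds \<open>M\<close> by \<open>n + 1\<close> times
  \<open>N\<close>, and a set off the closed set \<open>A\<close> is the increasing union of its
  slices.\<close>

lemma rel_class_in_M1_plus:
  fixes A :: "'a::metric_space set"
  assumes A: "closed A" "A \<noteq> {}" and sets_M: "sets M = sets borel"
    and fin: "(\<integral>\<^sup>+x. ennreal (infdist x A) \<partial>M) < \<infinity>"
    and tight: "\<And>e. 0 < e \<Longrightarrow>
      \<exists>K. compact K \<and> (\<integral>\<^sup>+x. ennreal (infdist x A) * indicator (- K) x \<partial>M) < ennreal e"
  shows "rel_equiv A `` {M} \<in> M1_plus A"
proof -
  note [measurable_cong] = sets_M
  let ?d = "\<lambda>x. ennreal (infdist x A)" and ?c = "rel_equiv A `` {M}"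
  have d_borel [measurable]: "(\<lambda>x. infdist x A) \<in> borel_measurable borel"
    by (intro borel_measurable_continuous_onI continuous_intros)
  have d_pos: "0 < infdist x A" if "x \<notin> A" for x
    using A that by (simp add: infdist_pos_not_in_closed)
  have c: "?c \<in> rel_borel_measures A" and M_in: "M \<in> ?c"
    using sets_M A by (auto simp: rel_borel_measures_def borel_measures_def rel_equiv_iff intro: quotientI)
  define N where "N = density M ?d"
  have sets_N [simp]: "sets N = sets borel" by (simp add: N_def sets_M)
  have space_N: "space N = UNIV" using sets_eq_imp_space_eq[OF sets_N] by simp
  have N: "emeasure N E = (\<integral>\<^sup>+x. ?d x * indicator E x \<partial>M)" if "E \<in> sets borel" for E
    unfolding N_def using that by (intro emeasure_density) (auto simp: sets_M)
  have "emeasure N (space N) = (\<integral>\<^sup>+x. ?d x \<partial>M)" by (simp add: N space_N)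
  then interpret N: finite_measure N using fin by (intro finite_measureI) auto
  have N_tight: "\<exists>K. compact K \<and> measure N (- K) < e" if "0 < e" for e
  proof -
    from tight[OF that] obtain K where K: "compact K" "(\<integral>\<^sup>+x. ?d x * indicator (- K) x \<partial>M) < ennreal e"
      by blast
    then have "emeasure N (- K) < ennreal e" by (subst N) (auto simp: compact_imp_closed)
    then have "measure N (- K) < e" by (simp add: N.emeasure_eq_measure ennreal_less_iff)
    then show ?thesis using K by blast
  qed
  have "rel_tight A ?c"
    unfolding rel_tight_def
  proof (intro ballI impI)
    fix E :: "'a set" assume E: "E \<in> sets borel" "E \<subseteq> - A"
    have rel: "rel_emeasure ?c F = emeasure M F" if "F \<in> sets borel" "F \<subseteq> E" for F
      using rel_emeasure_eq[OF A(1) c M_in, of F] that E by auto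
    have rel_K: "rel_emeasure ?c K = emeasure M K" if "compact K" "K \<subseteq> E" for K
      using that by (intro rel) (auto simp: compact_imp_closed)
    let ?S = "SUP K\<in>{K. compact K \<and> K \<subseteq> E}. emeasure M K"
    have S: "(SUP K\<in>{K. compact K \<and> K \<subseteq> E}. rel_emeasure ?c K) = ?S"
      using rel_K by (intro SUP_cong) auto
    define F where "F n = E \<inter> {x. inverse (real (Suc n)) \<le> infdist x A}" for n
    have F_borel: "F n \<in> sets borel" for n
      unfolding F_def using E by measurable
    have F_le: "emeasure M (F n) \<le> ?S" for n
    proof (rule ennreal_le_epsilon)
      fix e :: real assume e: "0 < e"
      \<comment> \<open>Dividing by \<open>Suc n\<close> compensates the factor lost when returning
        from \<open>N\<close> to \<open>M\<close> on the slice.\<close>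
      obtain K where K: "compact K" "K \<subseteq> F n" "measure N (F n - K) < e / real (Suc n)"
        using compact_inner_approximation[OF N.finite_measure_axioms sets_N F_borel _ N_tight, of "e / real (Suc n)" n] e
        by (auto simp del: of_nat_Suc)
      have K_borel: "K \<in> sets borel" "F n - K \<in> sets borel"
        using K F_borel by (auto simp: compact_imp_closed)
      have "emeasure M (F n - K) = (\<integral>\<^sup>+x. indicator (F n - K) x \<partial>M)"
        using K_borel by (simp add: sets_M)
      also have "\<dots> \<le> (\<integral>\<^sup>+x. ennreal (real (Suc n)) * (?d x * indicator (F n - K) x) \<partial>M)"
      proof (rule nn_integral_mono)
        fix x
        show "indicator (F n - K) x \<le> ennreal (real (Suc n)) * (?d x * indicator (F n - K) x)"
        proof (cases "x \<in> F n - K")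
          case True
          then have "1 \<le> real (Suc n) * infdist x A"
            by (simp add: F_def field_simps del: of_nat_Suc)
          then have "ennreal 1 \<le> ennreal (real (Suc n) * infdist x A)" by (rule ennreal_leI)
          then show ?thesis using True by (simp add: ennreal_mult infdist_nonneg)
        qed simp
      qed
      also have "\<dots> = ennreal (real (Suc n)) * emeasure N (F n - K)"
        using K_borel by (simp add: nn_integral_cmult N)
      also have "\<dots> = ennreal (real (Suc n) * measure N (F n - K))"
        by (simp add: N.emeasure_eq_measure ennreal_mult)
      also have "\<dots> \<le> ennreal e"
        using K(3) by (intro ennreal_leI) (simp add: field_simps)
      finally have *: "emeasure M (F n - K) \<le> ennreal e" .
      have "emeasure M (F n) \<le> emeasure M (K \<union> (F n - K))"
        using K_borel F_borel by (intro emeasure_mono) (auto simp: sets_M)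
      also have "\<dots> \<le> emeasure M K + emeasure M (F n - K)"
        using K_borel by (intro emeasure_subadditive) (simp_all add: sets_M)
      also have "\<dots> \<le> ?S + ennreal e"
        using K by (intro add_mono * SUP_upper) (auto simp: F_def)
      finally show "emeasure M (F n) \<le> ?S + ennreal e" .
    qed
    have E_eq: "E = (\<Union>n. F n)"
    proof (intro equalityI subsetI)
      fix x assume "x \<in> E"
      then have "0 < infdist x A" using E d_pos by auto
      then obtain n where "inverse (real (Suc n)) < infdist x A" using reals_Archimedean by blast
      then show "x \<in> (\<Union>n. F n)" using \<open>x \<in> E\<close> by (auto simp: F_def intro: less_imp_le)
    qed (auto simp: F_def)
    have "incseq F"
    proof (rule incseq_SucI)
      fix n
      have "inverse (real (Suc (Suc n))) \<le> inverse (real (Suc n))" by (simp add: field_simps)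
      then show "F n \<subseteq> F (Suc n)" unfolding F_def by (blast intro: order_trans)
    qed
    then have "emeasure M E = (SUP n. emeasure M (F n))"
      unfolding E_eq using F_borel by (intro SUP_emeasure_incseq[symmetric]) (auto simp: sets_M)
    also have "\<dots> \<le> ?S" by (intro SUP_least F_le)
    finally have "emeasure M E \<le> ?S" .
    moreover have "?S \<le> emeasure M E"
      using E by (intro SUP_least emeasure_mono) (auto simp: sets_M)
    ultimately show "rel_emeasure ?c E = (SUP K\<in>{K. compact K \<and> K \<subseteq> E}. rel_emeasure ?c K)"
      using S rel[OF E(1)] by simp
  qed
  moreover have "rel_nn_integral ?c ?d < \<infinity>"
  proof -
    have "rel_nn_integral ?c ?d = (\<integral>\<^sup>+x. ?d x \<partial>M)"
      using A by (intro rel_nn_integral_eq[OF A(1) c M_in]) auto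
    then show ?thesis using fin by simp
  qed
  ultimately show ?thesis using c by (simp add: M1_plus_def)
qed

lemma integrable_Lip:
  fixes A :: "'a::metric_space set"
  assumes "A \<noteq> {}" and sets_M: "sets M = sets borel"
    and fin: "(\<integral>\<^sup>+x. ennreal (infdist x A) \<partial>M) < \<infinity>" and f: "f \<in> Lip A"
  shows "integrable M f"
proof -
  note [measurable_cong] = sets_M
  obtain L where L: "0 \<le> L" "\<And>x. \<bar>f x\<bar> \<le> L * infdist x A"
    using Lip_le_infdist[OF f assms(1)] by blast
  have [measurable]: "(\<lambda>x. infdist x A) \<in> borel_measurable borel" "f \<in> borel_measurable borel"
    using f infdist_Lip_plus[of A A] by (auto intro: Lip_borel_measurable Lip_plus_imp_Lip)
  have "integrable M (\<lambda>x. infdist x A)"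
    using fin by (intro integrableI_bounded) (auto simp: infdist_nonneg)
  then have "integrable M (\<lambda>x. L * infdist x A)" by simp
  then show ?thesis
    by (rule Bochner_Integration.integrable_bound) (use L in \<open>auto simp: infdist_nonneg\<close>)
qed

context exhausted_functional
begin

definition rep_class :: "'a measure set" where
  "rep_class = rel_equiv A `` {rep_measure}"

lemma nn_integral_infdist_rep_measure: "(\<integral>\<^sup>+x. ennreal (infdist x A) \<partial>rep_measure) < \<infinity>"
  using nn_integral_rep_measure[OF infdist_Lip_plus[of A A]] by simp

text \<open>The distance to \<open>A\<close>, restricted to the complement of \<open>K\<close>, is
  an increasing limit of Lipschitz functions that lie below it and vanish on \<open>K\<close>, so
  the exhaustion bounds its integral. Using \<open>e / 2\<close> keeps the bound strict after the
  supremum.\<close>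

lemma rep_class_in_M1_plus: "rep_class \<in> M1_plus A"
  unfolding rep_class_def
proof (rule rel_class_in_M1_plus[OF closed_A A_nonempty sets_rep_measure nn_integral_infdist_rep_measure])
  fix e :: real assume e: "0 < e"
  let ?d = "\<lambda>x. infdist x A"
  have d: "?d \<in> Lip_plus A" by (rule infdist_Lip_plus) simp
  obtain K where K: "compact K" "K \<subseteq> - A" and
    small: "\<And>g. g \<in> Lip_plus A \<Longrightarrow> (\<And>x. x \<in> K \<Longrightarrow> g x = 0) \<Longrightarrow> (\<And>x. g x \<le> ?d x) \<Longrightarrow> P g < e / 2"
    using exhausted_compact[OF d, of "e / 2"] e by auto
  let ?C = "K \<union> A"
  have C: "closed ?C" "?C \<noteq> {}" using K closed_A A_nonempty by (auto simp: compact_imp_closed)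
  define u where "u k x = min (?d x) (real k * infdist x ?C)" for k x
  have u: "u k \<in> Lip_plus A" for k unfolding u_def by (rule Lip_plus_min_infdist[OF d])
  have inc: "incseq (\<lambda>k x. ennreal (u k x))"
    unfolding u_def
    by (intro incseq_SucI le_funI ennreal_leI min.mono mult_right_mono) (auto simp: infdist_nonneg)
  have "(\<integral>\<^sup>+x. ennreal (?d x) * indicator (- K) x \<partial>rep_measure) =
      (\<integral>\<^sup>+x. (SUP k. ennreal (u k x)) \<partial>rep_measure)"
    using min_infdist_SUP[OF C, of ?d] unfolding u_def
    by (intro nn_integral_cong) (auto simp: infdist_nonneg split: split_indicator)
  also have "\<dots> = (SUP k. \<integral>\<^sup>+x. ennreal (u k x) \<partial>rep_measure)"
    using Lip_borel_measurable[OF Lip_plus_imp_Lip[OF u]]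
    by (intro nn_integral_monotone_convergence_SUP inc) simp
  also have "\<dots> = (SUP k. ennreal (P (u k)))"
    by (simp add: nn_integral_rep_measure[OF u])
  also have "\<dots> \<le> ennreal (e / 2)"
  proof (rule SUP_least)
    fix k
    have "P (u k) < e / 2"
    proof (rule small[OF u])
      show "u k x = 0" if "x \<in> K" for x using that by (simp add: u_def infdist_nonneg min_absorb2)
    qed (simp add: u_def)
    then show "ennreal (P (u k)) \<le> ennreal (e / 2)" by (intro ennreal_leI) simp
  qed
  also have "\<dots> < ennreal e" using e by (intro ennreal_lessI) auto
  finally show "\<exists>K. compact K \<and>
      (\<integral>\<^sup>+x. ennreal (?d x) * indicator (- K) x \<partial>rep_measure) < ennreal e"
    using K by blast
qed

lemma rel_integral_rep_class:
  assumes f: "f \<in> Lip A"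
  shows "rel_integral rep_class f = P f"
proof -
  have c: "rep_class \<in> rel_borel_measures A" using rep_class_in_M1_plus by (simp add: M1_plus_def)
  have M: "rep_measure \<in> rep_class"
    using closed_A by (simp add: rep_class_def rel_equiv_iff borel_measures_def)
  have pos: "integral\<^sup>L rep_measure g = P g" if "g \<in> Lip_plus A" for g
    using nn_integral_rep_measure[OF that] Lip_plus_nonneg[OF that] P_nonneg[OF that]
      Lip_borel_measurable[OF Lip_plus_imp_Lip[OF that]]
    by (simp add: integral_eq_nn_integral)
  let ?p = "\<lambda>x. max (f x) 0" and ?n = "\<lambda>x. max (- 1 * f x) 0"
  have p: "?p \<in> Lip_plus A" "?n \<in> Lip_plus A" using f by (intro Lip_max_zero Lip_cmult; simp)+
  have eq: "f = (\<lambda>x. ?p x - ?n x)" by (auto simp: fun_eq_iff)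
  have int: "integrable rep_measure ?p" "integrable rep_measure ?n"
    using p by (intro integrable_Lip[OF A_nonempty sets_rep_measure nn_integral_infdist_rep_measure];
        simp add: Lip_plus_imp_Lip)+
  have "rel_integral rep_class f = integral\<^sup>L rep_measure f"
    using f by (intro rel_integral_eq[OF closed_A c M]) (auto simp: Lip_borel_measurable Lip_zero_on)
  also have "\<dots> = integral\<^sup>L rep_measure ?p - integral\<^sup>L rep_measure ?n"
    by (subst eq) (rule Bochner_Integration.integral_diff[OF int])
  also have "\<dots> = P ?p - P ?n" by (simp only: pos p)
  also have "\<dots> = P f"
    using P_diff[OF p[THEN Lip_plus_imp_Lip]] eq by simp
  finally show ?thesis .
qed

end

section \<open>The infimum of two positive functionals\<close>

lemma linear_functional_combine:
  assumes "linear_functional (Lip A) S" "linear_functional (Lip A) T"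
  shows "linear_functional (Lip A) (\<lambda>f. a * S f + b * T f)"
  using assms by (auto simp: linear_functional_def algebra_simps)

lemma positive_imp_order_bounded:
  assumes lin: "linear_functional (Lip A) S" and pos: "\<And>f. f \<in> Lip_plus A \<Longrightarrow> 0 \<le> S f"
  shows "order_bounded (Lip A) S"
  unfolding order_bounded_def
proof (intro ballI)
  fix a b assume ab: "a \<in> Lip A" "b \<in> Lip A"
  have mono: "S f \<le> S g" if "f \<in> Lip A" "g \<in> Lip A" "f \<le> g" for f g
    using pos[of "\<lambda>x. g x - f x"] linear_functional_diff[OF lin that(2,1)] Lip_diff[OF that(2,1)] that(3)
    by (simp add: nonneg_part_def le_fun_def)
  have "norm (S f) \<le> \<bar>S a\<bar> + \<bar>S b\<bar>" if "f \<in> Lip A" "a \<le> f" "f \<le> b" for f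
    using mono[OF ab(1) that(1,2)] mono[OF that(1) ab(2) that(3)] by auto
  then show "bounded (S ` {f \<in> Lip A. a \<le> f \<and> f \<le> b})"
    by (intro boundedI[of _ "\<bar>S a\<bar> + \<bar>S b\<bar>"]) auto
qed

text \<open>The difference \<open>R g - R h\<close> depends only on \<open>g - h\<close>, so
  linearity can be checked on any convenient decomposition instead of the positive and negative
  parts.\<close>

lemma linear_extension:
  assumes add: "\<And>f g. f \<in> Lip_plus A \<Longrightarrow> g \<in> Lip_plus A \<Longrightarrow> R (\<lambda>x. f x + g x) = R f + R g"
    and cmult: "\<And>c f. 0 \<le> c \<Longrightarrow> f \<in> Lip_plus A \<Longrightarrow> R (\<lambda>x. c * f x) = c * R f"
  obtains R' where "linear_functional (Lip A) R'" "\<And>f. f \<in> Lip_plus A \<Longrightarrow> R' f = R f"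
proof -
  define R' where "R' f = R (\<lambda>x. max (f x) 0) - R (\<lambda>x. max (- 1 * f x) 0)" for f
  have parts: "(\<lambda>x. max (f x) 0) \<in> Lip_plus A" "(\<lambda>x. max (- 1 * f x) 0) \<in> Lip_plus A" if "f \<in> Lip A" for f
    using that by (intro Lip_max_zero Lip_cmult; simp)+
  have R': "R' f = R g - R h" if "g \<in> Lip_plus A" "h \<in> Lip_plus A" "\<And>x. f x = g x - h x" for f g h
  proof -
    have "f = (\<lambda>x. g x - h x)" using that(3) by auto
    then have f: "f \<in> Lip A" using Lip_diff[OF that(1,2)[THEN Lip_plus_imp_Lip]] by simp
    \<comment> \<open>Two decompositions of \<open>f\<close> are compared without subtraction, so
      that additivity on the positive cone applies.\<close>
    have "(\<lambda>x. max (f x) 0 + h x) = (\<lambda>x. g x + max (- 1 * f x) 0)"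
      using that(3) by (auto simp: fun_eq_iff max_def)
    then show ?thesis
      using add[OF parts(1)[OF f] that(2)] add[OF that(1) parts(2)[OF f]] by (simp add: R'_def)
  qed
  have "linear_functional (Lip A) R'"
    unfolding linear_functional_def
  proof (intro conjI ballI allI)
    fix f g assume f: "f \<in> Lip A" and g: "g \<in> Lip A"
    have "R' (\<lambda>x. f x + g x) = R (\<lambda>x. max (f x) 0 + max (g x) 0) -
      R (\<lambda>x. max (- 1 * f x) 0 + max (- 1 * g x) 0)"
      by (intro R' Lip_plus_add parts f g) auto
    then show "R' (\<lambda>x. f x + g x) = R' f + R' g"
      using add[OF parts(1)[OF f] parts(1)[OF g]] add[OF parts(2)[OF f] parts(2)[OF g]]
      by (simp add: R'_def)
  next
    fix c f assume f: "f \<in> Lip A"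
    show "R' (\<lambda>x. c * f x) = c * R' f"
    proof (cases "0 \<le> c")
      case True
      have "R' (\<lambda>x. c * f x) = R (\<lambda>x. c * max (f x) 0) - R (\<lambda>x. c * max (- 1 * f x) 0)"
        by (intro R' Lip_plus_cmult parts f True) (auto simp: max_def algebra_simps)
      then show ?thesis
        using cmult[OF True parts(1)[OF f]] cmult[OF True parts(2)[OF f]]
        by (simp add: R'_def algebra_simps)
    next
      case False
      then have c: "0 \<le> - c" by simp
      have "R' (\<lambda>x. c * f x) = R (\<lambda>x. - c * max (- 1 * f x) 0) - R (\<lambda>x. - c * max (f x) 0)"
        by (intro R' Lip_plus_cmult parts f c) (auto simp: max_def algebra_simps)
      then show ?thesis
        using cmult[OF c parts(1)[OF f]] cmult[OF c parts(2)[OF f]]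
        by (simp add: R'_def algebra_simps)
    qed
  qed
  moreover have "R' f = R f" if "f \<in> Lip_plus A" for f
    using R'[OF that Lip_plus_zero, of f] cmult[OF order_refl Lip_plus_zero] by simp
  ultimately show thesis using that by blast
qed

text \<open>The Riesz--Kantorovich formula for the infimum in the order dual.\<close>

definition functional_inf ::
  "'a::metric_space set \<Rightarrow> (('a \<Rightarrow> real) \<Rightarrow> real) \<Rightarrow> (('a \<Rightarrow> real) \<Rightarrow> real) \<Rightarrow> ('a \<Rightarrow> real) \<Rightarrow> real" where
  "functional_inf A P N f = Inf {P g + N h | g h.
     g \<in> Lip_plus A \<and> h \<in> Lip_plus A \<and> (\<lambda>x. g x + h x) = f}"

context
  fixes A :: "'a::metric_space set" and P N :: "('a \<Rightarrow> real) \<Rightarrow> real"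
  assumes P: "linear_functional (Lip A) P" "\<And>f. f \<in> Lip_plus A \<Longrightarrow> 0 \<le> P f"
    and N: "linear_functional (Lip A) N" "\<And>f. f \<in> Lip_plus A \<Longrightarrow> 0 \<le> N f"
begin

lemma functional_inf_le:
  assumes "g \<in> Lip_plus A" "h \<in> Lip_plus A" "\<And>x. g x + h x = f x"
  shows "functional_inf A P N f \<le> P g + N h"
  unfolding functional_inf_def
proof (rule cInf_lower)
  have "(\<lambda>x. g x + h x) = f" using assms by auto
  then show "P g + N h \<in> {P g + N h | g h. g \<in> Lip_plus A \<and> h \<in> Lip_plus A \<and> (\<lambda>x. g x + h x) = f}"
    using assms by blast
  show "bdd_below {P g + N h | g h. g \<in> Lip_plus A \<and> h \<in> Lip_plus A \<and> (\<lambda>x. g x + h x) = f}"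
    using P(2) N(2) by (intro bdd_belowI[of _ 0]) (auto intro: add_nonneg_nonneg)
qed

lemma functional_inf_greatest:
  assumes f: "f \<in> Lip_plus A"
    and le: "\<And>g h. g \<in> Lip_plus A \<Longrightarrow> h \<in> Lip_plus A \<Longrightarrow> (\<And>x. g x + h x = f x) \<Longrightarrow> c \<le> P g + N h"
  shows "c \<le> functional_inf A P N f"
  unfolding functional_inf_def
proof (rule cInf_greatest)
  have "P f + N (\<lambda>x. 0) \<in> {P g + N h | g h. g \<in> Lip_plus A \<and> h \<in> Lip_plus A \<and> (\<lambda>x. g x + h x) = f}"
    using f Lip_plus_zero[of A]
    by (intro CollectI exI[of _ f] exI[of _ "\<lambda>x. 0"] conjI) simp_all
  then show "{P g + N h | g h. g \<in> Lip_plus A \<and> h \<in> Lip_plus A \<and> (\<lambda>x. g x + h x) = f} \<noteq> {}" by blast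
qed (use le in auto)

text \<open>Decompositions of the summands add up, which gives one inequality. For the other, the
  Riesz decomposition property splits a decomposition of the sum into decompositions of the
  summands.\<close>

lemma functional_inf_add:
  assumes f: "f1 \<in> Lip_plus A" "f2 \<in> Lip_plus A"
  shows "functional_inf A P N (\<lambda>x. f1 x + f2 x) = functional_inf A P N f1 + functional_inf A P N f2"
proof (rule antisym)
  let ?R = "functional_inf A P N"
  note Lp = Lip_plus_imp_Lip
  have "?R (\<lambda>x. f1 x + f2 x) - ?R f1 \<le> ?R f2"
  proof (rule functional_inf_greatest[OF f(2)])
    fix g2 h2 assume 2: "g2 \<in> Lip_plus A" "h2 \<in> Lip_plus A" "\<And>x. g2 x + h2 x = f2 x"
    have "?R (\<lambda>x. f1 x + f2 x) - (P g2 + N h2) \<le> ?R f1"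
    proof (rule functional_inf_greatest[OF f(1)])
      fix g1 h1 assume 1: "g1 \<in> Lip_plus A" "h1 \<in> Lip_plus A" "\<And>x. g1 x + h1 x = f1 x"
      have "?R (\<lambda>x. f1 x + f2 x) \<le> P (\<lambda>x. g1 x + g2 x) + N (\<lambda>x. h1 x + h2 x)"
        using 1 2 by (intro functional_inf_le Lip_plus_add) (auto simp flip: 1(3) 2(3))
      also have "\<dots> = P g1 + P g2 + (N h1 + N h2)"
        using 1 2 by (simp add: linear_functional_add[OF P(1)] linear_functional_add[OF N(1)] Lp)
      finally show "?R (\<lambda>x. f1 x + f2 x) - (P g2 + N h2) \<le> P g1 + N h1" by simp
    qed
    then show "?R (\<lambda>x. f1 x + f2 x) - ?R f1 \<le> P g2 + N h2" by simp
  qed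
  then show "?R (\<lambda>x. f1 x + f2 x) \<le> ?R f1 + ?R f2" by simp
  show "?R f1 + ?R f2 \<le> ?R (\<lambda>x. f1 x + f2 x)"
  proof (rule functional_inf_greatest[OF Lip_plus_add[OF f]])
    fix g h assume g: "g \<in> Lip_plus A" and h: "h \<in> Lip_plus A" and gh: "\<And>x. g x + h x = f1 x + f2 x"
    \<comment> \<open>\<open>g\<close> gives as much of \<open>f1\<close> as it can. The rest
      \<open>f1 - g1\<close> fits below \<open>h\<close> because \<open>f1 - g = h - f2\<close>, and
      what remains of \<open>g\<close> and \<open>h\<close> adds up to \<open>f2\<close>.\<close>
    define g1 where "g1 x = min (g x) (f1 x)" for x
    have le: "g1 x \<le> g x" "g1 x \<le> f1 x" "f1 x - g1 x \<le> h x" for x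
      using gh[of x] Lip_plus_nonneg[OF f(2), of x] Lip_plus_nonneg[OF h, of x] by (auto simp: g1_def)
    have g1: "g1 \<in> Lip_plus A"
      unfolding g1_def using g f(1) Lip_plus_antimono[of "{}" A] by (intro Lip_plus_min) auto
    have h1: "(\<lambda>x. f1 x - g1 x) \<in> Lip_plus A" using f(1) g1 le(2) by (rule Lip_plus_diff)
    have g2: "(\<lambda>x. g x - g1 x) \<in> Lip_plus A" using g g1 le(1) by (rule Lip_plus_diff)
    have h2: "(\<lambda>x. h x - (f1 x - g1 x)) \<in> Lip_plus A" using h h1 le(3) by (rule Lip_plus_diff)
    have "?R f1 \<le> P g1 + N (\<lambda>x. f1 x - g1 x)"
      by (intro functional_inf_le g1 h1) simp
    moreover have "?R f2 \<le> P (\<lambda>x. g x - g1 x) + N (\<lambda>x. h x - (f1 x - g1 x))"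
      using gh by (intro functional_inf_le g2 h2) (simp add: algebra_simps)
    ultimately show "?R f1 + ?R f2 \<le> P g + N h"
      using linear_functional_diff[OF P(1), of g g1] linear_functional_diff[OF N(1), of h "\<lambda>x. f1 x - g1 x"]
        g g1 h h1 by (simp add: Lp)
  qed
qed

lemma functional_inf_cmult_le:
  assumes c: "0 < c" and f: "f \<in> Lip_plus A"
  shows "functional_inf A P N (\<lambda>x. c * f x) \<le> c * functional_inf A P N f"
proof -
  have "functional_inf A P N (\<lambda>x. c * f x) / c \<le> functional_inf A P N f"
  proof (rule functional_inf_greatest[OF f])
    fix g h assume gh: "g \<in> Lip_plus A" "h \<in> Lip_plus A" "\<And>x. g x + h x = f x"
    have "functional_inf A P N (\<lambda>x. c * f x) \<le> P (\<lambda>x. c * g x) + N (\<lambda>x. c * h x)"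
      using c gh by (intro functional_inf_le Lip_plus_cmult) (auto simp: algebra_simps simp flip: gh(3))
    also have "\<dots> = c * (P g + N h)"
      using gh by (simp add: linear_functional_cmult[OF P(1)] linear_functional_cmult[OF N(1)]
          Lip_plus_imp_Lip algebra_simps)
    finally show "functional_inf A P N (\<lambda>x. c * f x) / c \<le> P g + N h"
      using c by (simp add: field_simps)
  qed
  then show ?thesis using c by (simp add: field_simps)
qed

lemma functional_inf_nonneg: "f \<in> Lip_plus A \<Longrightarrow> 0 \<le> functional_inf A P N f"
  by (rule functional_inf_greatest) (auto intro: add_nonneg_nonneg P N)

lemma functional_inf_le_left: "f \<in> Lip_plus A \<Longrightarrow> functional_inf A P N f \<le> P f"
  using functional_inf_le[of f "\<lambda>x. 0" f] Lip_plus_zero[of A]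
    linear_functional_cmult[OF N(1) Lip_plus_imp_Lip[OF Lip_plus_zero], of 0] by simp

lemma functional_inf_le_right: "f \<in> Lip_plus A \<Longrightarrow> functional_inf A P N f \<le> N f"
  using functional_inf_le[of "\<lambda>x. 0" f f] Lip_plus_zero[of A]
    linear_functional_cmult[OF P(1) Lip_plus_imp_Lip[OF Lip_plus_zero], of 0] by simp

lemma functional_inf_cmult:
  assumes c: "0 \<le> c" and f: "f \<in> Lip_plus A"
  shows "functional_inf A P N (\<lambda>x. c * f x) = c * functional_inf A P N f"
proof (cases "c = 0")
  case True
  have "P (\<lambda>x. 0) = 0"
    using linear_functional_cmult[OF P(1) Lip_plus_imp_Lip[OF Lip_plus_zero], of 0] by simp
  then show ?thesis
    using True functional_inf_le_left[OF Lip_plus_zero] functional_inf_nonneg[OF Lip_plus_zero] by simp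
next
  case False
  then have c: "0 < c" using c by simp
  have "functional_inf A P N (\<lambda>x. (1 / c) * (c * f x)) \<le> (1 / c) * functional_inf A P N (\<lambda>x. c * f x)"
    using c f by (intro functional_inf_cmult_le Lip_plus_cmult) auto
  then have "c * functional_inf A P N f \<le> functional_inf A P N (\<lambda>x. c * f x)"
    using c by (simp add: field_simps)
  then show ?thesis using functional_inf_cmult_le[OF c f] by simp
qed

end

text \<open>If the infimum \<open>R\<close> of the positive and negative parts of \<open>T\<close> were nonzero, then
  \<open>\<bar>T\<bar> - 2 R\<close> would be a smaller upper bound of \<open>T\<close> and \<open>- T\<close> than the modulus.\<close>

lemma modulus_parts_disjoint:
  assumes T: "linear_functional (Lip A) T" and mod: "is_modulus (Lip A) T S" and f: "f \<in> Lip_plus A"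
  shows "functional_inf A (\<lambda>f. 1/2 * S f + 1/2 * T f) (\<lambda>f. 1/2 * S f + - 1/2 * T f) f = 0"
proof -
  let ?P = "\<lambda>f. 1/2 * S f + 1/2 * T f" and ?N = "\<lambda>f. 1/2 * S f + - 1/2 * T f"
  let ?R = "functional_inf A ?P ?N"
  have S: "linear_functional (Lip A) S" using mod by (simp add: is_modulus_def order_dual_def)
  have ST: "0 \<le> S f - T f" "0 \<le> S f + T f" if "f \<in> Lip_plus A" for f
    using mod that by (auto simp: is_modulus_def functional_le_def)
  have P: "linear_functional (Lip A) ?P" "\<And>f. f \<in> Lip_plus A \<Longrightarrow> 0 \<le> ?P f"
    using linear_functional_combine[OF S T] ST(2) by (blast, fastforce)
  have N: "linear_functional (Lip A) ?N" "\<And>f. f \<in> Lip_plus A \<Longrightarrow> 0 \<le> ?N f"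
    using linear_functional_combine[OF S T] ST(1) by (blast, fastforce)
  obtain R where R: "linear_functional (Lip A) R" "\<And>f. f \<in> Lip_plus A \<Longrightarrow> R f = ?R f"
    using linear_extension[of A ?R, OF functional_inf_add[OF P N] functional_inf_cmult[OF P N]] by blast
  define U where "U f = 1 * S f + (- 2) * R f" for f
  have U: "linear_functional (Lip A) U" unfolding U_def using S R(1) by (rule linear_functional_combine)
  \<comment> \<open>\<open>R\<close> below the positive part gives \<open>S - 2 R \<ge> - T\<close>;
    \<open>R\<close> below the negative part gives \<open>S - 2 R \<ge> T\<close>.\<close>
  have TU: "T f \<le> U f" "- T f \<le> U f" if "f \<in> Lip_plus A" for f
    using functional_inf_le_left[OF P N that] functional_inf_le_right[OF P N that] R(2)[OF that]
    by (auto simp: U_def)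
  then have "0 \<le> U f" if "f \<in> Lip_plus A" for f using TU[OF that] by linarith
  then have "U \<in> order_dual (Lip A)"
    using U positive_imp_order_bounded[OF U] by (simp add: order_dual_def)
  moreover have "functional_le (Lip A) T U" "functional_le (Lip A) (\<lambda>f. - T f) U"
    using TU by (fastforce simp: functional_le_def)+
  ultimately have "functional_le (Lip A) S U" using mod by (simp add: is_modulus_def)
  then have "R f \<le> 0" using f by (simp add: functional_le_def U_def)
  then show ?thesis using functional_inf_nonneg[OF P N f] R(2)[OF f] by simp
qed

text \<open>The compact set of \<open>S\<close> serves for \<open>P\<close> too. It is taken for
  \<open>e / 2\<close> because a supremum of values below a bound may attain that bound.\<close>

lemma exhausted_functional_dominated:
  assumes S: "exhausted_functional A S" and P: "linear_functional (Lip A) P"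
    and PS: "\<And>f. f \<in> Lip_plus A \<Longrightarrow> 0 \<le> P f" "\<And>f. f \<in> Lip_plus A \<Longrightarrow> P f \<le> S f"
  shows "exhausted_functional A P"
proof -
  interpret S: exhausted_functional A S by fact
  show ?thesis
  proof unfold_locales
    show "pos_exhausted_by_compacts A P"
      unfolding pos_exhausted_by_compacts_def
    proof (intro ballI allI impI)
      fix f and e :: real assume f: "f \<in> Lip_plus A" and e: "0 < e"
      obtain K where K: "compact K" "K \<subseteq> - A" and
        small: "\<And>g. g \<in> Lip_plus A \<Longrightarrow> (\<And>x. x \<in> K \<Longrightarrow> g x = 0) \<Longrightarrow> (\<And>x. g x \<le> f x) \<Longrightarrow> S g < e / 2"
        using S.exhausted_compact[OF f, of "e / 2"] e by auto
      have "Sup {P g | g. g \<in> Lip_plus A \<and> (\<forall>x\<in>K. g x = 0) \<and> g \<le> f} \<le> e / 2"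
      proof (rule cSup_least)
        have "P (\<lambda>x. 0) \<in> {P g | g. g \<in> Lip_plus A \<and> (\<forall>x\<in>K. g x = 0) \<and> g \<le> f}"
          using Lip_plus_zero[of A] Lip_plus_nonneg[OF f] by (auto simp: le_fun_def)
        then show "{P g | g. g \<in> Lip_plus A \<and> (\<forall>x\<in>K. g x = 0) \<and> g \<le> f} \<noteq> {}" by blast
        fix r assume "r \<in> {P g | g. g \<in> Lip_plus A \<and> (\<forall>x\<in>K. g x = 0) \<and> g \<le> f}"
        then obtain g where "r = P g" "g \<in> Lip_plus A" "\<forall>x\<in>K. g x = 0" "g \<le> f" by blast
        then show "r \<le> e / 2" using small[of g] PS(2)[of g] by (force simp: le_fun_def)
      qed
      then show "\<exists>K. compact K \<and> K \<subseteq> - A \<and>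
          Sup {P g | g. g \<in> Lip_plus A \<and> (\<forall>x\<in>K. g x = 0) \<and> g \<le> f} < e"
        using K e by (intro exI[of _ K]) auto
    qed
  qed (use S.closed_A S.A_nonempty P PS in auto)
qed

section \<open>Uniqueness of the minimal pair\<close>

text \<open>The representative is the very one chosen in \<open>rel_integral\<close>, so the
  integrals agree for every function.\<close>

lemma M1_plus_representative:
  fixes A :: "'a::metric_space set"
  assumes A: "closed A" and c: "c \<in> M1_plus A"
  obtains m where "m \<in> c" "sets m = sets borel" "(\<integral>\<^sup>+x. ennreal (infdist x A) \<partial>m) < \<infinity>"
    "\<And>f. rel_integral c f = integral\<^sup>L m f"
proof
  let ?m = "SOME m. m \<in> c"
  from c obtain m0 where m0: "m0 \<in> borel_measures" "c = rel_equiv A `` {m0}"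
    by (auto simp: M1_plus_def rel_borel_measures_def quotient_def)
  then have "m0 \<in> c" using A by (simp add: rel_equiv_iff)
  then show m: "?m \<in> c" by (rule someI)
  have "sets m = sets borel" if "m \<in> c" for m
    using that m0(2) A by (simp add: rel_equiv_iff borel_measures_def)
  from this[OF m] show "sets ?m = sets borel" .
  show "(\<integral>\<^sup>+x. ennreal (infdist x A) \<partial>?m) < \<infinity>"
    using c by (simp add: M1_plus_def rel_nn_integral_def)
qed (simp add: rel_integral_def)

lemma rel_integral_nonneg:
  assumes "f \<in> Lip_plus A"
  shows "0 \<le> rel_integral c f"
  unfolding rel_integral_def using Lip_plus_nonneg[OF assms] by simp

lemma rel_integral_add:
  assumes "closed A" "A \<noteq> {}" "c \<in> M1_plus A" "f \<in> Lip A" "g \<in> Lip A"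
  shows "rel_integral c (\<lambda>x. f x + g x) = rel_integral c f + rel_integral c g"
proof -
  obtain m where m: "sets m = sets borel" "(\<integral>\<^sup>+x. ennreal (infdist x A) \<partial>m) < \<infinity>"
    "\<And>f. rel_integral c f = integral\<^sup>L m f"
    using M1_plus_representative[OF assms(1,3)] by metis
  show ?thesis
    unfolding m(3) using assms(4,5)
    by (intro Bochner_Integration.integral_add integrable_Lip[OF assms(2) m(1,2)])
qed

text \<open>For a decomposition \<open>f = g + h\<close> with small minimality sum, the
  \<open>\<mu>\<close>-integral of \<open>f\<close> is \<open>T h\<close> plus that sum, and
  \<open>T h\<close> is at most the \<open>\<mu>'\<close>-integral of \<open>h\<close>, hence of
  \<open>f\<close>.\<close>

lemma minimal_pair_least:
  assumes A: "closed A" "A \<noteq> {}"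
    and 1: "\<mu> \<in> M1_plus A" "\<nu> \<in> M1_plus A" "represents A T \<mu> \<nu>" "minimal_pair A \<mu> \<nu>"
    and 2: "\<mu>' \<in> M1_plus A" "\<nu>' \<in> M1_plus A" "represents A T \<mu>' \<nu>'"
    and f: "f \<in> Lip_plus A"
  shows "rel_integral \<mu> f \<le> rel_integral \<mu>' f"
proof (rule field_le_epsilon)
  fix e :: real assume e: "0 < e"
  let ?I = "{rel_integral \<mu> g + rel_integral \<nu> h | g h.
    g \<in> Lip_plus A \<and> h \<in> Lip_plus A \<and> (\<lambda>x. g x + h x) = f}"
  have "rel_integral \<mu> f + rel_integral \<nu> (\<lambda>x. 0) \<in> ?I"
    using f Lip_plus_zero[of A]
    by (intro CollectI exI[of _ f] exI[of _ "\<lambda>x. 0"] conjI) simp_all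
  then have "?I \<noteq> {}" by blast
  moreover have "Inf ?I < e" using 1(4) f e unfolding minimal_pair_def by simp
  ultimately obtain r where "r \<in> ?I" "r < e" by (rule cInf_lessD[THEN bexE])
  then obtain g h where g: "g \<in> Lip_plus A" and h: "h \<in> Lip_plus A" and gh: "(\<lambda>x. g x + h x) = f"
    and small: "rel_integral \<mu> g + rel_integral \<nu> h < e" by auto
  have add: "rel_integral c f = rel_integral c g + rel_integral c h" if "c \<in> M1_plus A" for c
    using rel_integral_add[OF A that g[THEN Lip_plus_imp_Lip] h[THEN Lip_plus_imp_Lip]] gh by simp
  have T: "rel_integral \<mu> h - rel_integral \<nu> h = rel_integral \<mu>' h - rel_integral \<nu>' h"
    using 1(3) 2(3) Lip_plus_imp_Lip[OF h] by (simp add: represents_def)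
  show "rel_integral \<mu> f \<le> rel_integral \<mu>' f + e"
    using add[OF 1(1)] add[OF 2(1)] T small rel_integral_nonneg[OF g, of \<mu>']
      rel_integral_nonneg[OF h, of \<nu>'] by linarith
qed

text \<open>Weighted by the distance to \<open>A\<close>, both measures are finite, and Lipschitz
  approximation from inside shows that they agree on open sets, hence on Borel sets. Dividing by the
  distance recovers the measures off \<open>A\<close>.\<close>

lemma M1_plus_eqI:
  fixes A :: "'a::metric_space set"
  assumes A: "closed A" "A \<noteq> {}" and \<mu>: "\<mu> \<in> M1_plus A" and \<nu>: "\<nu> \<in> M1_plus A"
    and eq: "\<And>f. f \<in> Lip_plus A \<Longrightarrow> rel_integral \<mu> f = rel_integral \<nu> f"
  shows "\<mu> = \<nu>"
proof -
  let ?d = "\<lambda>x. infdist x A"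
  have d: "?d \<in> Lip_plus A" by (rule infdist_Lip_plus) simp
  have d_borel [measurable]: "?d \<in> borel_measurable borel"
    using d by (intro Lip_borel_measurable Lip_plus_imp_Lip)
  obtain m where m: "m \<in> \<mu>" and sets_m: "sets m = sets borel" and fin_m: "(\<integral>\<^sup>+x. ennreal (?d x) \<partial>m) < \<infinity>"
    and int_m: "\<And>f. rel_integral \<mu> f = integral\<^sup>L m f"
    using M1_plus_representative[OF A(1) \<mu>] by metis
  obtain n where n: "n \<in> \<nu>" and sets_n: "sets n = sets borel" and fin_n: "(\<integral>\<^sup>+x. ennreal (?d x) \<partial>n) < \<infinity>"
    and int_n: "\<And>f. rel_integral \<nu> f = integral\<^sup>L n f"
    using M1_plus_representative[OF A(1) \<nu>] by metis
  note [measurable_cong] = sets_m sets_n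
  have nn_eq: "(\<integral>\<^sup>+x. ennreal (f x) \<partial>m) = (\<integral>\<^sup>+x. ennreal (f x) \<partial>n)" if f: "f \<in> Lip_plus A" for f
  proof -
    have "(\<integral>\<^sup>+x. ennreal (f x) \<partial>m) = ennreal (integral\<^sup>L m f)"
      by (intro nn_integral_eq_integral integrable_Lip[OF A(2) sets_m fin_m] Lip_plus_imp_Lip f)
        (simp add: Lip_plus_nonneg[OF f])
    also have "integral\<^sup>L m f = integral\<^sup>L n f" using eq[OF f] by (simp add: int_m int_n)
    also have "ennreal (integral\<^sup>L n f) = (\<integral>\<^sup>+x. ennreal (f x) \<partial>n)"
      by (intro nn_integral_eq_integral[symmetric] integrable_Lip[OF A(2) sets_n fin_n] Lip_plus_imp_Lip f)
        (simp add: Lip_plus_nonneg[OF f])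
    finally show ?thesis .
  qed
  have open_eq: "(\<integral>\<^sup>+x. ennreal (?d x) * indicator U x \<partial>m) = (\<integral>\<^sup>+x. ennreal (?d x) * indicator U x \<partial>n)"
    if U: "open U" for U
  proof -
    let ?C = "- U \<union> A"
    have C: "closed ?C" "?C \<noteq> {}" using U A by auto
    define u where "u k x = min (?d x) (real k * infdist x ?C)" for k x
    have u: "u k \<in> Lip_plus A" for k
      unfolding u_def using d Lip_plus_cmult[OF infdist_Lip_plus[of "{}" ?C], of "real k"]
      by (intro Lip_plus_min) auto
    have [measurable]: "u k \<in> borel_measurable borel" for k
      by (rule Lip_borel_measurable[OF Lip_plus_imp_Lip[OF u]])
    have inc: "incseq (\<lambda>k x. ennreal (u k x))"
      unfolding u_def
      by (intro incseq_SucI le_funI ennreal_leI min.mono mult_right_mono) (auto simp: infdist_nonneg)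
    have sup: "ennreal (?d x) * indicator U x = (SUP k. ennreal (u k x))" for x
      using min_infdist_SUP[OF C, of ?d x] unfolding u_def
      by (auto simp: infdist_nonneg split: split_indicator_asm split_indicator)
    have "(\<integral>\<^sup>+x. ennreal (?d x) * indicator U x \<partial>M) = (SUP k. \<integral>\<^sup>+x. ennreal (u k x) \<partial>M)"
      if [measurable_cong]: "sets M = sets borel" for M
      unfolding sup by (intro nn_integral_monotone_convergence_SUP inc) measurable
    then show ?thesis using nn_eq[OF u] by (simp add: sets_m sets_n)
  qed
  \<comment> \<open>Open sets are an intersection-stable generator; the finite total mass lets the
    whole space serve as the exhausting sequence.\<close>
  have dens: "density m (\<lambda>x. ennreal (?d x)) = density n (\<lambda>x. ennreal (?d x))"
  proof (rule measure_eqI_generator_eq[where E = "{U. open U}" and \<Omega> = UNIV and A = "\<lambda>_. UNIV"])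
    show "Int_stable {U :: 'a set. open U}" by (auto simp: Int_stable_def)
    show "emeasure (density m (\<lambda>x. ennreal (?d x))) U = emeasure (density n (\<lambda>x. ennreal (?d x))) U"
      if "U \<in> {U. open U}" for U
      using that open_eq by (simp add: emeasure_density sets_m sets_n)
    show "emeasure (density m (\<lambda>x. ennreal (?d x))) UNIV \<noteq> \<infinity>"
      using fin_m by (simp add: emeasure_density sets_m)
  qed (auto simp: sets_m sets_n borel_def)
  have "emeasure m E = emeasure n E" if E: "E \<in> sets borel" "E \<subseteq> - A" for E
  proof -
    have "emeasure M E = (\<integral>\<^sup>+x. ennreal (inverse (?d x)) * indicator E x \<partial>density M (\<lambda>x. ennreal (?d x)))"
      if sets_M [measurable_cong]: "sets M = sets borel" for M
    proof -
      have [measurable]: "E \<in> sets M" using E by (simp add: sets_M)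
      have "(\<integral>\<^sup>+x. ennreal (inverse (?d x)) * indicator E x \<partial>density M (\<lambda>x. ennreal (?d x))) =
          (\<integral>\<^sup>+x. ennreal (?d x) * (ennreal (inverse (?d x)) * indicator E x) \<partial>M)"
        by (intro nn_integral_density) measurable
      also have "\<dots> = (\<integral>\<^sup>+x. indicator E x \<partial>M)"
      proof (rule nn_integral_cong)
        fix x
        show "ennreal (?d x) * (ennreal (inverse (?d x)) * indicator E x) = indicator E x"
        proof (cases "x \<in> E")
          case True
          then have "0 < ?d x" using E(2) A by (intro infdist_pos_not_in_closed) auto
          then show ?thesis using True by (simp add: ennreal_mult[symmetric])
        qed simp
      qed
      also have "\<dots> = emeasure M E" by simp
      finally show ?thesis by simp
    qed
    then show ?thesis using dens sets_m sets_n by metis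
  qed
  then have "(m, n) \<in> rel_equiv A"
    using A by (auto simp: rel_equiv_iff borel_measures_def sets_m sets_n)
  then show ?thesis
    using quotient_eqI[OF equiv_rel_equiv[OF A(1)] _ _ m n] \<mu> \<nu>
    by (simp add: M1_plus_def rel_borel_measures_def)
qed

lemma represents_swap: "represents A T \<mu> \<nu> \<Longrightarrow> represents A (\<lambda>f. - T f) \<nu> \<mu>"
  by (simp add: represents_def)

lemma minimal_pair_swap:
  fixes A :: "'a::metric_space set"
  assumes min: "minimal_pair A \<mu> \<nu>"
  shows "minimal_pair A \<nu> \<mu>"
proof -
  \<comment> \<open>Stated for arbitrary \<open>a\<close> and \<open>b\<close>, so that exchanging
    them yields the reverse inclusion.\<close>
  have "{a g + b h | g h. g \<in> Lip_plus A \<and> h \<in> Lip_plus A \<and> (\<lambda>x. g x + h x) = f} \<subseteq>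
    {b g + a h | g h. g \<in> Lip_plus A \<and> h \<in> Lip_plus A \<and> (\<lambda>x. g x + h x) = f}"
    for a b :: "('a \<Rightarrow> real) \<Rightarrow> real" and f
  proof clarify
    fix g h assume "g \<in> Lip_plus A" "h \<in> Lip_plus A"
    then show "\<exists>g' h'. a g + b h = b g' + a h' \<and> g' \<in> Lip_plus A \<and> h' \<in> Lip_plus A \<and>
        (\<lambda>x. g' x + h' x) = (\<lambda>x. g x + h x)"
      by (intro exI[of _ h] exI[of _ g]) (simp add: add.commute)
  qed
  then have "{rel_integral \<nu> g + rel_integral \<mu> h | g h.
      g \<in> Lip_plus A \<and> h \<in> Lip_plus A \<and> (\<lambda>x. g x + h x) = f} =
    {rel_integral \<mu> g + rel_integral \<nu> h | g h.
      g \<in> Lip_plus A \<and> h \<in> Lip_plus A \<and> (\<lambda>x. g x + h x) = f}" for f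
    by (intro equalityI)
  then show ?thesis using min by (simp add: minimal_pair_def)
qed

text \<open>Each pair is least against the other, which settles the first components; the second
  ones follow from the same argument for \<open>- T\<close> with the pairs swapped.\<close>

lemma minimal_pair_unique:
  assumes A: "closed A" "A \<noteq> {}"
    and 1: "\<mu> \<in> M1_plus A" "\<nu> \<in> M1_plus A" "represents A T \<mu> \<nu>" "minimal_pair A \<mu> \<nu>"
    and 2: "\<mu>' \<in> M1_plus A" "\<nu>' \<in> M1_plus A" "represents A T \<mu>' \<nu>'" "minimal_pair A \<mu>' \<nu>'"
  shows "\<mu> = \<mu>'" "\<nu> = \<nu>'"
proof -
  show "\<mu> = \<mu>'"
    using minimal_pair_least[OF A 1 2(1-3)] minimal_pair_least[OF A 2 1(1-3)]
    by (intro M1_plus_eqI[OF A 1(1) 2(1)]) (simp add: order_antisym)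
  note s = represents_swap minimal_pair_swap
  show "\<nu> = \<nu>'"
    using minimal_pair_least[OF A 1(2,1) s(1)[OF 1(3)] s(2)[OF 1(4)] 2(2,1) s(1)[OF 2(3)]]
      minimal_pair_least[OF A 2(2,1) s(1)[OF 2(3)] s(2)[OF 2(4)] 1(2,1) s(1)[OF 1(3)]]
    by (intro M1_plus_eqI[OF A 1(2) 2(2)]) (simp add: order_antisym)
qed

section \<open>Existence of the minimal pair and the representation theorem\<close>

lemma minimal_pair_exists:
  fixes A :: "'a::metric_space set"
  assumes A: "closed A" "A \<noteq> {}" and T: "linear_functional (Lip A) T"
    and ex: "exhausted_by_compacts A T"
  obtains \<mu> \<nu> where "\<mu> \<in> M1_plus A" "\<nu> \<in> M1_plus A" "represents A T \<mu> \<nu>" "minimal_pair A \<mu> \<nu>"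
proof -
  from ex obtain S where mod: "is_modulus (Lip A) T S" and exS: "pos_exhausted_by_compacts A S"
    by (auto simp: exhausted_by_compacts_def)
  have S: "linear_functional (Lip A) S" using mod by (simp add: is_modulus_def order_dual_def)
  have ST: "T f \<le> S f" "- T f \<le> S f" if "f \<in> Lip_plus A" for f
    using mod that by (fastforce simp: is_modulus_def functional_le_def)+
  have S_pos: "0 \<le> S f" if "f \<in> Lip_plus A" for f using ST[OF that] by linarith
  have exh: "exhausted_functional A S" using A S S_pos exS by (simp add: exhausted_functional_def)
  let ?P = "\<lambda>f. 1/2 * S f + 1/2 * T f" and ?N = "\<lambda>f. 1/2 * S f + - 1/2 * T f"
  interpret P: exhausted_functional A ?P
  proof (rule exhausted_functional_dominated[OF exh linear_functional_combine[OF S T]])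
    show "0 \<le> ?P f" "?P f \<le> S f" if "f \<in> Lip_plus A" for f using ST[OF that] by linarith+
  qed
  interpret N: exhausted_functional A ?N
  proof (rule exhausted_functional_dominated[OF exh linear_functional_combine[OF S T]])
    show "0 \<le> ?N f" "?N f \<le> S f" if "f \<in> Lip_plus A" for f using ST[OF that] by linarith+
  qed
  have "represents A T P.rep_class N.rep_class"
    unfolding represents_def
  proof
    fix f assume f: "f \<in> Lip A"
    show "T f = rel_integral P.rep_class f - rel_integral N.rep_class f"
      unfolding P.rel_integral_rep_class[OF f] N.rel_integral_rep_class[OF f] by simp
  qed
  moreover have "minimal_pair A P.rep_class N.rep_class"
    unfolding minimal_pair_def
  proof
    fix f assume f: "f \<in> Lip_plus A"
    \<comment> \<open>Rewriting integrals as functional values turns minimality into the vanishing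
      of the Riesz-Kantorovich infimum of the two parts.\<close>
    have "{rel_integral P.rep_class g + rel_integral N.rep_class h | g h.
        g \<in> Lip_plus A \<and> h \<in> Lip_plus A \<and> (\<lambda>x. g x + h x) = f} =
      {?P g + ?N h | g h. g \<in> Lip_plus A \<and> h \<in> Lip_plus A \<and> (\<lambda>x. g x + h x) = f}"
      using P.rel_integral_rep_class[OF Lip_plus_imp_Lip] N.rel_integral_rep_class[OF Lip_plus_imp_Lip]
      by (intro Collect_cong) (metis (no_types, lifting))
    then show "Inf {rel_integral P.rep_class g + rel_integral N.rep_class h | g h.
        g \<in> Lip_plus A \<and> h \<in> Lip_plus A \<and> (\<lambda>x. g x + h x) = f} = 0"
      using modulus_parts_disjoint[OF T mod f] by (simp only: functional_inf_def)
  qed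
  ultimately show thesis
    using that P.rep_class_in_M1_plus N.rep_class_in_M1_plus by blast
qed

theorem theorem5p19:
  fixes A :: "'a::metric_space set" and T :: "('a \<Rightarrow> real) \<Rightarrow> real"
  assumes "closed A" and "A \<noteq> {}"
    and "linear_functional (Lip A) T"
    and "order_bounded (Lip A) T"
    and "seq_order_continuous (Lip A) T"
    and "exhausted_by_compacts A T"
  shows "(\<exists>\<mu>\<in>M1_plus A. \<exists>\<nu>\<in>M1_plus A. represents A T \<mu> \<nu>) \<and>
    (\<exists>!(\<mu>, \<nu>). \<mu> \<in> M1_plus A \<and> \<nu> \<in> M1_plus A \<and> represents A T \<mu> \<nu> \<and> minimal_pair A \<mu> \<nu>)"
proof -
  obtain \<mu> \<nu> where *: "\<mu> \<in> M1_plus A" "\<nu> \<in> M1_plus A" "represents A T \<mu> \<nu>" "minimal_pair A \<mu> \<nu>"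
    using minimal_pair_exists[OF assms(1,2,3,6)] by blast
  show ?thesis
  proof
    show "\<exists>\<mu>\<in>M1_plus A. \<exists>\<nu>\<in>M1_plus A. represents A T \<mu> \<nu>" using * by blast
    show "\<exists>!(\<mu>, \<nu>). \<mu> \<in> M1_plus A \<and> \<nu> \<in> M1_plus A \<and> represents A T \<mu> \<nu> \<and> minimal_pair A \<mu> \<nu>"
    proof (rule ex1I[of _ "(\<mu>, \<nu>)"])
      fix p assume "case p of (\<mu>, \<nu>) \<Rightarrow>
        \<mu> \<in> M1_plus A \<and> \<nu> \<in> M1_plus A \<and> represents A T \<mu> \<nu> \<and> minimal_pair A \<mu> \<nu>"
      then show "p = (\<mu>, \<nu>)"
        using minimal_pair_unique[OF assms(1,2) _ _ _ _ *] by (cases p) auto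
    qed (use * in simp)
  qed
qed

end
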